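(* Let $(n_j)_{j\ge 1}$ be a sequence of integers $n_j\geq 2$ with $n_j\to\infty$ such that each $n_j$ has the form $n_j=\prod_{k=1}^{m_j}p_k^{\alpha_{k}^{(j)}}$, where $m_j\ge 1$ is an integer and $\alpha_1^{(j)}\ge\alpha_2^{(j)}\ge\cdots\ge\alpha_{m_j}^{(j)}\ge 1$ are integers. Define $\varepsilon_{m_j}(n_j)$ by $n_j=\left(\prod_{k=1}^{m_j}p_k\right)^{1+\varepsilon_{m_j}(n_j)}$. (1) If $\lim_{j\to\infty}\varepsilon_{m_j}(n_j)=0$ and there exist positive integer constants $A,K_0$ (independent of $j$) such that $A\ge\alpha_{K_0}^{(j)}\ge\alpha_{K_0+1}^{(j)}\ge\cdots\ge\alpha_{m_j}^{(j)}$ for all $j$ with $m_j\ge K_0$, then $$\lim_{j\to\infty}\left(e^{\gamma}n_j\log\log n_j-\sigma(n_j)\right)>0$$ (the limit being taken in the extended reals, with the value $+\infty$ allowed). (2) If $\lim_{j\to\infty}\varepsilon_{m_j}(n_j)=0$, then for all sufficiently large $j$ there exist positive integers $K_1^{(j)},\dots,K_{s_j}^{(j)}\in\{1,\dots,m_j\}$, with $1\le s_j\le m_j$, such that $\alpha^{(j)}_{K_i^{(j)}}\le K_i^{(j)}$ for $i=1,\dots,s_j$, and $$\lim_{j\to\infty}\frac{K^{(j)}}{m_j}=0,\qquad\text{where } K^{(j)}=\min\{K_1^{(j)},\dots,K_{s_j}^{(j)}\}.$$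
   Context: $p_k$ denotes the $k$-th prime number in ascending order, $\sigma(n)=\sum_{d\mid n}d$ is the sum-of-divisors function, $\gamma$ is Euler's constant, and $\log$ is the natural logarithm. Equivalently, $\varepsilon_{m}(n)=\left(\log\prod_{k=1}^{m}p_k^{\alpha_k}\right)\left(\log\prod_{k=1}^{m}p_k\right)^{-1}-1\ge 0$ for $n=\prod_{k=1}^m p_k^{\alpha_k}$. *)

theory Defs
  imports "HOL-Analysis.Analysis" "HOL-Computational_Algebra.Primes" "HOL-Library.Infinite_Set"
begin

(* nth_prime 1 = 2, nth_prime 2 = 3, ...; the library function enumerate counts from 0.
   The value at 0 is a dummy and is not used. *)
definition nth_prime :: "nat \<Rightarrow> nat" where
  "nth_prime k = enumerate {p. prime p} (k - 1)"

definition divisor_sum :: "nat \<Rightarrow> nat" where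
  "divisor_sum n = (\<Sum>d | d dvd n. d)"

end

theory Submission imports Defs "HOL-Library.Discrete_Functions" begin

text \<open>Let \<open>p\<close> be the largest prime factor of \<open>n\<close> and \<open>\<theta>(p)\<close> the logarithm of the primorial, so that
  \<open>ln n = (1 + \<epsilon>) \<theta>(p)\<close>.  As \<open>\<epsilon>\<close> tends to 0 and \<open>n\<close> to infinity, the number \<open>m\<close> of prime factors and
  \<open>p\<close> tend to infinity.

  For the first part, \<open>\<sigma>(n) / n\<close> is at most \<open>\<Prod>(1 - p\<^sub>k powr -(\<alpha>\<^sub>k + 1))\<close> times the Mertens product
  \<open>\<Prod>1 / (1 - 1 / q)\<close> over the primes \<open>q \<le> p\<close>.  The exponent at \<open>K0\<close> is at most \<open>A\<close>, so the first
  factor is at most \<open>1 - c0\<close> with a constant \<open>c0 > 0\<close>; by Mertens' third theorem the second is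
  at most \<open>e\<^sup>\<gamma> ln p (1 + o(1))\<close>.  On the other hand \<open>ln (ln n) \<ge> ln p - O(1)\<close> by Chebyshev's lower bound
  \<open>\<theta>(p) \<ge> c p\<close>.  So the difference in question is eventually at least \<open>n\<close> times a positive multiple of \<open>ln p\<close>,
  and the limit is \<open>\<infinity>\<close>.

  For the second part, suppose that the first \<open>r\<close> exponents exceed their indices.  By
  monotonicity each of them exceeds \<open>r\<close>, which forces \<open>\<epsilon> \<theta>(p) \<ge> r\<^sup>2 ln 2\<close>, whereas
  \<open>\<theta>(p) = O(m\<^sup>2)\<close>.  Hence \<open>r / m = O(sqrt \<epsilon>)\<close>, and the first index at which the exponent does not exceed
  it is \<open>o(m)\<close>.

  The analytic input is the upper bound in Mertens' third theorem, with its exact constant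
  (\<open>mertens_third_upper\<close>).  Factorising \<open>N!\<close> gives Mertens' first theorem and with it Chebyshev's
  lower bound; partial summation yields the second theorem with an unknown constant.  The
  constant is found by an Abelian comparison (\<open>mertens_constant_le\<close>): replace the prime reciprocals
  by a harmonic series placed on the powers of two, which has the same growth and in which Euler's
  constant is visible, weight the difference by \<open>n powr -\<delta>\<close>, estimate it by Euler products and
  the bound \<open>1 + 1 / \<delta>\<close> for the zeta function at \<open>1 + \<delta>\<close>, and let \<open>\<delta>\<close> tend to 0.\<close>

section \<open>Chebyshev's upper bound\<close>

definition primes_upto :: "nat \<Rightarrow> nat set" where
  "primes_upto N = {p. prime p \<and> p \<le> N}"

definition theta :: "nat \<Rightarrow> real" where
  "theta N = (\<Sum>p\<in>primes_upto N. ln (real p))"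

lemma finite_primes_upto [simp, intro]: "finite (primes_upto N)"
  unfolding primes_upto_def by simp

lemma primes_upto_ge_2: "p \<in> primes_upto N \<Longrightarrow> p \<ge> 2"
  by (simp add: primes_upto_def prime_ge_2_nat)

lemma primes_upto_mono: "M \<le> N \<Longrightarrow> primes_upto M \<subseteq> primes_upto N"
  by (auto simp: primes_upto_def)

text \<open>The coefficient occurs twice in its row, at positions \<open>k\<close> and \<open>k + 1\<close>, and
  the row sums to \<open>2 ^ (2 * k + 1)\<close>.\<close>

lemma central_binomial_odd_le: "(2 * k + 1) choose k \<le> 4 ^ k"
proof -
  have eq: "(2 * k + 1) choose k = (2 * k + 1) choose (k + 1)"
    by (subst binomial_symmetric) auto
  have "2 * ((2 * k + 1) choose k) = (\<Sum>i\<in>{k, k+1}. (2 * k + 1) choose i)"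
    using eq by simp
  also have "\<dots> \<le> (\<Sum>i\<le>2 * k + 1. (2 * k + 1) choose i)"
    by (rule sum_mono2) auto
  also have "\<dots> = 2 ^ (2 * k + 1)" by (rule choose_row_sum)
  also have "\<dots> = 2 * 4 ^ k" by (simp add: power_mult)
  finally show ?thesis by simp
qed

lemma prod_primes_dvd:
  fixes x :: nat
  assumes "finite S" "\<And>p. p \<in> S \<Longrightarrow> prime p" "\<And>p. p \<in> S \<Longrightarrow> p dvd x"
  shows "\<Prod>S dvd x"
  using assms
proof (induction S rule: finite_induct)
  case (insert p S)
  have "coprime p (\<Prod>S)"
    using insert by (intro prod_coprime_right primes_coprime) auto
  with insert show ?case by (auto intro: divides_mult)
qed auto

text \<open>Erdos's induction: an even number above 2 contributes no prime, and the primes in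
  \<open>(k + 1, 2k + 1]\<close> all divide the binomial coefficient \<open>(2k + 1 choose k)\<close>,
  because they divide its numerator but not its denominator.\<close>

lemma prod_primes_upto_le: "\<Prod>(primes_upto N) \<le> 4 ^ N"
proof (induction N rule: less_induct)
  case (less N)
  consider "N \<le> 1" | "N = 2" | "N > 2" "even N" | k where "N = 2 * k + 1" "k \<ge> 1"
  proof (cases "N \<le> 2 \<or> even N")
    case True
    thus ?thesis using that(1-3) by (cases "N \<le> 1"; cases "N = 2") auto
  next
    case False
    then obtain k where "N = 2 * k + 1" by (auto elim: oddE)
    with False show ?thesis using that(4)[of k] by auto
  qed
  then show ?case
  proof cases
    case 1
    hence "primes_upto N = {}" using primes_upto_ge_2[of _ N] by (force simp: primes_upto_def)
    thus ?thesis by simp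
  next
    case 2
    have "primes_upto 2 = {2}"
      by (auto simp: primes_upto_def dest: prime_ge_2_nat)
    thus ?thesis using 2 by simp
  next
    case 3
    hence "\<not> prime N" using prime_odd_nat by blast
    hence "primes_upto N = primes_upto (N - 1)"
      unfolding primes_upto_def by (intro Collect_cong) (use 3 in \<open>auto simp: le_less\<close>)
    moreover have "\<Prod>(primes_upto (N - 1)) \<le> 4 ^ (N - 1)" using 3 by (intro less) auto
    moreover have "(4::nat) ^ (N - 1) \<le> 4 ^ N" by (rule power_increasing) auto
    ultimately show ?thesis by (metis le_trans)
  next
    case 4
    define S where "S = {p. prime p \<and> k + 1 < p \<and> p \<le> 2 * k + 1}"
    have fS: "finite S" unfolding S_def by simp
    have "primes_upto N = primes_upto (k + 1) \<union> S"
      using 4 by (auto simp: primes_upto_def S_def)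
    moreover have "primes_upto (k + 1) \<inter> S = {}" by (auto simp: primes_upto_def S_def)
    ultimately have "\<Prod>(primes_upto N) = \<Prod>(primes_upto (k + 1)) * \<Prod>S"
      using fS by (simp add: prod.union_disjoint)
    moreover have "\<Prod>(primes_upto (k + 1)) \<le> 4 ^ (k + 1)" using 4 by (intro less) auto
    moreover have "\<Prod>S dvd (2 * k + 1) choose k"
    proof (rule prod_primes_dvd[OF fS])
      fix p assume p: "p \<in> S"
      hence pr: "prime p" by (simp add: S_def)
      have "fact k * fact (k + 1) * ((2 * k + 1) choose k) = (fact (2 * k + 1) :: nat)"
        using binomial_fact_lemma[of k "2 * k + 1"] by (simp add: numeral_2_eq_2)
      moreover have "p dvd fact (2 * k + 1)" using p by (simp add: prime_dvd_fact_iff S_def del: fact_Suc)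
      ultimately have "p dvd fact k * fact (k + 1) * ((2 * k + 1) choose k)" by metis
      moreover have "\<not> p dvd fact k" "\<not> p dvd fact (k + 1)"
        using p pr by (simp_all add: prime_dvd_fact_iff S_def del: fact_Suc)
      ultimately show "p dvd (2 * k + 1) choose k"
        using pr prime_dvd_mult_nat by blast
    qed (simp add: S_def)
    hence "\<Prod>S \<le> (2 * k + 1) choose k" by (rule dvd_imp_le) simp
    hence "\<Prod>S \<le> 4 ^ k" using central_binomial_odd_le le_trans by blast
    ultimately have "\<Prod>(primes_upto N) \<le> 4 ^ (k + 1) * 4 ^ k" by (simp add: mult_le_mono)
    also have "\<dots> = 4 ^ N" using 4 by (simp add: power_add power_mult mult_2)
    finally show ?thesis .
  qed
qed

lemma theta_le: "theta N \<le> real N * ln 4"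
proof -
  have pos: "real (\<Prod>(primes_upto N)) > 0"
    by (auto simp: primes_upto_def prime_gt_0_nat intro!: prod_pos)
  have "theta N = ln (\<Prod>p\<in>primes_upto N. real p)"
    unfolding theta_def by (rule ln_prod[symmetric]) (auto simp: primes_upto_def prime_gt_0_nat)
  also have "\<dots> = ln (real (\<Prod>(primes_upto N)))" by simp
  also have "\<dots> \<le> ln (real (4 ^ N))"
    using prod_primes_upto_le[of N] pos by (subst ln_le_cancel_iff) (auto simp del: of_nat_power of_nat_prod)
  also have "\<dots> = real N * ln 4" by (simp add: ln_realpow)
  finally show ?thesis .
qed

section \<open>Mertens' first theorem and Chebyshev's lower bound\<close>

lemma card_multiples:
  assumes "d > 0"
  shows "card {m\<in>{1..N}. d dvd m} = N div d"
proof -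
  have "{m\<in>{1..N}. d dvd m} = (\<lambda>k. d * k) ` {1..N div d}"
  proof (intro equalityI subsetI)
    fix m assume "m \<in> {m\<in>{1..N}. d dvd m}"
    then obtain k where k: "m = d * k" "1 \<le> m" "m \<le> N" by auto
    have "k \<le> N div d" using k assms by (simp add: less_eq_div_iff_mult_less_eq mult.commute)
    thus "m \<in> (\<lambda>k. d * k) ` {1..N div d}" using k by auto
  next
    fix m assume "m \<in> (\<lambda>k. d * k) ` {1..N div d}"
    then obtain k where k: "m = d * k" "1 \<le> k" "k \<le> N div d"
      by (metis atLeastAtMost_iff imageE)
    have "d * k \<le> N" using k assms by (simp add: less_eq_div_iff_mult_less_eq mult.commute)
    thus "m \<in> {m\<in>{1..N}. d dvd m}" using k assms by auto
  qed
  moreover have "inj_on (\<lambda>k. d * k) {1..N div d}" using assms by (auto simp: inj_on_def)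
  ultimately show ?thesis by (simp add: card_image)
qed

text \<open>Legendre's formula: each \<open>m \<le> N\<close> is counted once for every power of \<open>p\<close> that
  divides it.  Powers beyond \<open>p ^ N\<close> contribute nothing, so the sum may stop at \<open>N\<close>.\<close>

lemma multiplicity_fact_eq:
  fixes p :: nat
  assumes p: "prime p"
  shows "multiplicity p (fact N :: nat) = (\<Sum>i=1..N. N div p ^ i)"
proof -
  have v: "multiplicity p m = (\<Sum>i=1..N. if p ^ i dvd m then 1 else 0)" if "m \<in> {1..N}" for m
  proof -
    have m0: "m \<noteq> 0" "\<not> is_unit p" using that p by (auto dest: prime_gt_1_nat)
    have iff: "p ^ i dvd m \<longleftrightarrow> i \<le> multiplicity p m" for i
      using m0 by (rule power_dvd_iff_le_multiplicity)
    have "p ^ multiplicity p m \<le> m" using m0 by (intro dvd_imp_le multiplicity_dvd) auto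
    moreover have "multiplicity p m < p ^ multiplicity p m"
      using p by (intro power_gt_expt) (auto dest: prime_gt_1_nat)
    ultimately have "multiplicity p m \<le> N" using that by auto
    hence "{i\<in>{1..N}. p ^ i dvd m} = {1..multiplicity p m}"
      unfolding iff by auto
    thus ?thesis by (simp add: sum.If_cases Int_def)
  qed
  have "multiplicity p (fact N :: nat) = multiplicity p (\<Prod>m\<in>{1..N}. m)"
    by (simp add: fact_prod)
  also have "\<dots> = (\<Sum>m\<in>{1..N}. multiplicity p m)"
    using p by (intro prime_elem_multiplicity_prod_distrib) auto
  also have "\<dots> = (\<Sum>m\<in>{1..N}. \<Sum>i=1..N. if p ^ i dvd m then 1 else 0)"
    using v by (intro sum.cong) auto
  also have "\<dots> = (\<Sum>i=1..N. \<Sum>m\<in>{1..N}. if p ^ i dvd m then 1 else 0)" by (rule sum.swap)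
  also have "\<dots> = (\<Sum>i=1..N. card {m\<in>{1..N}. p ^ i dvd m})"
    by (intro sum.cong) (simp_all add: sum.If_cases Int_def)
  also have "\<dots> = (\<Sum>i=1..N. N div p ^ i)"
    using p by (intro sum.cong card_multiples) (auto dest: prime_gt_0_nat)
  finally show ?thesis .
qed

lemma ln_fact_eq: "ln (fact N :: real) = (\<Sum>p\<in>primes_upto N. multiplicity p (fact N :: nat) * ln (real p))"
proof -
  have "(fact N :: nat) = (\<Prod>p\<in>prime_factors (fact N). p ^ multiplicity p (fact N :: nat))"
    by (rule prime_factorization_nat) simp
  also have "prime_factors (fact N :: nat) = primes_upto N"
    by (auto simp: prime_factors_fact primes_upto_def dest: prime_ge_2_nat)
  finally have "real (fact N) = real (\<Prod>p\<in>primes_upto N. p ^ multiplicity p (fact N :: nat))"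
    by presburger
  hence "ln (fact N :: real) = ln (\<Prod>p\<in>primes_upto N. real p ^ multiplicity p (fact N :: nat))"
    by simp
  also have "\<dots> = (\<Sum>p\<in>primes_upto N. ln (real p ^ multiplicity p (fact N :: nat)))"
    by (rule ln_prod) (auto simp: primes_upto_def prime_gt_0_nat)
  also have "\<dots> = (\<Sum>p\<in>primes_upto N. multiplicity p (fact N :: nat) * ln (real p))"
    by (intro sum.cong) (auto simp: primes_upto_def ln_realpow prime_gt_0_nat)
  finally show ?thesis .
qed

text \<open>The first term of Legendre's formula alone gives the lower bound; the upper bound is
  the full geometric series.\<close>

lemma multiplicity_fact_bounds:
  fixes p N :: nat
  assumes p: "prime p" and N: "p \<le> N"
  shows "real (multiplicity p (fact N :: nat)) \<ge> real N / real p - 1"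
    and "real (multiplicity p (fact N :: nat)) \<le> real N / (real p - 1)"
proof -
  have p1: "p > 1" using p by (rule prime_gt_1_nat)
  have "N div p ^ 1 \<le> (\<Sum>i=1..N. N div p ^ i)"
    using p1 N by (intro member_le_sum) auto
  moreover have "real N / real p - 1 \<le> real (N div p)"
    using floor_divide_of_nat_eq[of N p, where ?'a = real] by linarith
  ultimately show "real (multiplicity p (fact N :: nat)) \<ge> real N / real p - 1"
    unfolding multiplicity_fact_eq[OF p] by (metis le_trans of_nat_le_iff order_trans power_one_right)
  have "real (\<Sum>i=1..N. N div p ^ i) = (\<Sum>i=1..N. real (N div p ^ i))" by simp
  also have "\<dots> \<le> (\<Sum>i=1..N. real N * (1 / real p) ^ i)"
  proof (rule sum_mono)
    fix i
    have "real (N div p ^ i) \<le> real N / real (p ^ i)" by (rule of_nat_div_le_of_nat)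
    thus "real (N div p ^ i) \<le> real N * (1 / real p) ^ i" by (simp add: power_divide)
  qed
  also have "\<dots> = real N * (\<Sum>i=1..N. (1 / real p) ^ i)" by (simp add: sum_distrib_left)
  also have "(\<Sum>i=1..N. (1 / real p) ^ i) \<le> 1 / (real p - 1)"
  proof -
    have eq: "(real p - 1) * (\<Sum>i=1..n. (1 / real p) ^ i) = 1 - (1 / real p) ^ n" for n
      using p1 by (induction n) (auto simp: field_simps)
    have "(real p - 1) * (\<Sum>i=1..N. (1 / real p) ^ i) \<le> 1" unfolding eq by simp
    thus ?thesis using p1 by (simp add: field_simps)
  qed
  finally show "real (multiplicity p (fact N :: nat)) \<le> real N / (real p - 1)"
    unfolding multiplicity_fact_eq[OF p] by (simp add: mult_left_mono)
qed

text \<open>A weak form of Stirling's formula; the lower bound is the \<open>N\<close>-th term of the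
  exponential series at \<open>N\<close>.\<close>

lemma ln_fact_bounds:
  assumes "N \<ge> 1"
  shows "ln (fact N :: real) \<le> real N * ln (real N)"
    and "ln (fact N :: real) \<ge> real N * ln (real N) - real N"
proof -
  have "(fact N :: real) \<le> real (N ^ N)"
    using fact_le_power[of N, where ?'a = real] by simp
  hence "ln (fact N :: real) \<le> ln (real N ^ N)" using assms by (subst ln_le_cancel_iff) auto
  thus "ln (fact N :: real) \<le> real N * ln (real N)" using assms by (simp add: ln_realpow)
  have "(\<Sum>i\<in>{N}. inverse (fact i) * real N ^ i) \<le> (\<Sum>i. inverse (fact i) * real N ^ i)"
    by (intro sum_le_suminf) (use summable_exp[of "real N"] in auto)
  also have "\<dots> = exp (real N)" unfolding exp_def by (simp add: divide_inverse scaleR_conv_of_real)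
  finally have "real N ^ N \<le> fact N * exp (real N)" by (simp add: field_simps)
  hence "ln (real N ^ N) \<le> ln (fact N * exp (real N))" using assms by (subst ln_le_cancel_iff) auto
  thus "ln (fact N :: real) \<ge> real N * ln (real N) - real N"
    using assms by (simp add: ln_realpow ln_mult)
qed

text \<open>Both estimates compare the factorisation of \<open>N!\<close> with \<open>ln N! = N ln N + O(N)\<close> and divide
  by \<open>N\<close>.  The rounding in \<open>N / p - 1\<close> costs the Chebyshev function, which is \<open>O(N)\<close>;
  replacing \<open>1 / p\<close> by \<open>1 / (p - 1)\<close> costs a convergent series.\<close>

theorem mertens_first:
  "\<exists>K\<ge>0. \<forall>N\<ge>1. \<bar>(\<Sum>p\<in>primes_upto N. ln (real p) / real p) - ln (real N)\<bar> \<le> K"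
proof -
  \<comment> \<open>A summable majorant of the error \<open>ln p / (p (p - 1))\<close>.\<close>
  define z where "z n = 4 * real n powr (-3/2)" for n :: nat
  have sz: "summable z" unfolding z_def
    by (intro summable_mult) (simp add: summable_real_powr_iff)
  have z0: "z n \<ge> 0" for n by (simp add: z_def)
  have zb: "ln (real p) / (real p * (real p - 1)) \<le> z p" if "p \<ge> 2" for p
  proof -
    have "ln (real p) \<le> (real p powr (1/2)) / (1/2)" by (rule ln_powr_bound) (use that in auto)
    hence "ln (real p) / (real p * (real p - 1)) \<le> 2 * real p powr (1/2) / (real p * (real p - 1))"
      using that by (intro divide_right_mono) auto
    also have "\<dots> \<le> 2 * real p powr (1/2) / (real p * (real p / 2))"
      using that by (intro divide_left_mono mult_left_mono) auto
    also have "\<dots> = 4 * (real p powr (1/2) / real p powr 2)"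
      using that by (simp add: power2_eq_square)
    also have "\<dots> = z p" unfolding z_def by (subst powr_diff[symmetric]) simp
    finally show ?thesis .
  qed
  define K where "K = max (ln 4) (1 + suminf z)"
  have "\<bar>(\<Sum>p\<in>primes_upto N. ln (real p) / real p) - ln (real N)\<bar> \<le> K" if N: "N \<ge> 1" for N
  proof -
    let ?S = "\<Sum>p\<in>primes_upto N. ln (real p) / real p"
    have "real N * ?S - theta N = (\<Sum>p\<in>primes_upto N. (real N / real p - 1) * ln (real p))"
      unfolding theta_def by (simp add: sum_distrib_left sum_subtractf[symmetric] algebra_simps)
    also have "\<dots> \<le> (\<Sum>p\<in>primes_upto N. multiplicity p (fact N :: nat) * ln (real p))"
      by (intro sum_mono mult_right_mono multiplicity_fact_bounds)
         (auto simp: primes_upto_def dest: prime_gt_0_nat)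
    also have "\<dots> \<le> real N * ln (real N)"
      using ln_fact_bounds(1)[OF N] unfolding ln_fact_eq .
    finally have "real N * ?S \<le> real N * (ln (real N) + ln 4)"
      using theta_le[of N] by (simp add: algebra_simps)
    hence 1: "?S \<le> ln (real N) + ln 4" using N by simp
    have "real N * ln (real N) - real N \<le> (\<Sum>p\<in>primes_upto N. multiplicity p (fact N :: nat) * ln (real p))"
      using ln_fact_bounds(2)[OF N] unfolding ln_fact_eq .
    also have "\<dots> \<le> (\<Sum>p\<in>primes_upto N. real N / (real p - 1) * ln (real p))"
      by (intro sum_mono mult_right_mono multiplicity_fact_bounds)
         (auto simp: primes_upto_def dest: prime_gt_0_nat)
    also have "\<dots> = (\<Sum>p\<in>primes_upto N. real N * (ln (real p) / real p)
                        + real N * (ln (real p) / (real p * (real p - 1))))"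
    proof (intro sum.cong refl)
      fix p assume "p \<in> primes_upto N"
      hence "real p \<ge> 2" using primes_upto_ge_2 by fastforce
      thus "real N / (real p - 1) * ln (real p) = real N * (ln (real p) / real p)
                        + real N * (ln (real p) / (real p * (real p - 1)))"
        by (simp add: divide_simps) (simp add: algebra_simps)
    qed
    also have "\<dots> = real N * (?S + (\<Sum>p\<in>primes_upto N. ln (real p) / (real p * (real p - 1))))"
      by (simp add: sum.distrib sum_distrib_left distrib_left)
    also have "\<dots> \<le> real N * (?S + suminf z)"
    proof (intro mult_left_mono add_left_mono)
      have "(\<Sum>p\<in>primes_upto N. ln (real p) / (real p * (real p - 1))) \<le> (\<Sum>p\<in>primes_upto N. z p)"
        by (intro sum_mono zb primes_upto_ge_2)
      also have "\<dots> \<le> suminf z" by (intro sum_le_suminf sz) (auto simp: z0)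
      finally show "(\<Sum>p\<in>primes_upto N. ln (real p) / (real p * (real p - 1))) \<le> suminf z" .
    qed simp
    finally have "real N * ln (real N) \<le> real N * (?S + suminf z + 1)" by (simp add: algebra_simps)
    hence 2: "ln (real N) \<le> ?S + suminf z + 1" using N by simp
    show ?thesis using 1 2 unfolding K_def by linarith
  qed
  moreover have "K \<ge> 0" unfolding K_def by (rule max.coboundedI1) simp
  ultimately show ?thesis by blast
qed

text \<open>By the first theorem of Mertens the sum of \<open>ln p / p\<close> over \<open>N / C < p \<le> N\<close> is at least
  \<open>ln C\<close> up to a bounded error, hence at least 1 once \<open>C\<close> is large.  Each such summand is at most
  \<open>ln p\<close> times \<open>C / N\<close>.\<close>

theorem chebyshev_theta_lower:
  "\<exists>c>0. \<forall>N\<ge>2. theta N \<ge> c * real N"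
proof -
  obtain K where K: "K \<ge> 0"
    "\<And>N. N \<ge> 1 \<Longrightarrow> \<bar>(\<Sum>p\<in>primes_upto N. ln (real p) / real p) - ln (real N)\<bar> \<le> K"
    using mertens_first by auto
  \<comment> \<open>The error in Mertens' theorem enters at \<open>N\<close> and at \<open>N div C\<close>, hence the factor 2.\<close>
  define C where "C = nat \<lceil>exp (2 * K + 1)\<rceil>"
  have Cg: "real C \<ge> exp (2 * K + 1)" unfolding C_def by linarith
  have C1: "real C \<ge> 1" using Cg K(1) by (smt (verit) one_le_exp_iff)
  have lnC: "ln (real C) \<ge> 2 * K + 1" using Cg C1 by (subst ln_ge_iff) auto
  \<comment> \<open>The second entry covers \<open>N < C\<close>, where the prime 2 alone gives \<open>ln 2\<close>.\<close>
  define c where "c = min (1 / real C) (ln 2 / real C)"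
  have c: "c > 0" using C1 by (auto simp: c_def)
  have "theta N \<ge> c * real N" if N: "N \<ge> 2" for N
  proof (cases "N < C")
    case True
    have "ln 2 \<le> theta N" unfolding theta_def
      using member_le_sum[of 2 "primes_upto N" "\<lambda>p. ln (real p)"] N
      by (auto simp: primes_upto_def prime_gt_0_nat Suc_leI)
    moreover have "c * real N \<le> ln 2 / real C * real C" using True c
      by (intro mult_mono) (auto simp: c_def)
    ultimately show ?thesis using C1 by simp
  next
    case False
    define M where "M = N div C"
    have CN: "C > 0" "C \<le> N" using C1 False by auto
    have M1: "M \<ge> 1" unfolding M_def using CN by (simp add: div_greater_zero_iff Suc_leI)
    have MN: "M \<le> N" unfolding M_def by simp
    let ?S = "\<lambda>N. \<Sum>p\<in>primes_upto N. ln (real p) / real p"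
    have "real M \<le> real N / real C" unfolding M_def by (rule of_nat_div_le_of_nat)
    hence "ln (real M) \<le> ln (real N / real C)" using M1 by (subst ln_le_cancel_iff) (auto simp: N CN)
    also have "\<dots> = ln (real N) - ln (real C)" using CN by (simp add: ln_div)
    finally have "?S N - ?S M \<ge> 1"
      using K(2)[of N] K(2)[OF M1] lnC N by linarith
    also have "?S N - ?S M = (\<Sum>p\<in>primes_upto N - primes_upto M. ln (real p) / real p)"
      using MN by (subst sum_diff) (auto dest: primes_upto_mono)
    also have "\<dots> \<le> (\<Sum>p\<in>primes_upto N - primes_upto M. ln (real p) * (real C / real N))"
    proof (rule sum_mono)
      fix p assume p: "p \<in> primes_upto N - primes_upto M"
      hence "p > N div C" "p > 0" by (auto simp: primes_upto_def M_def dest: prime_gt_0_nat)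
      hence "N < p * C" using CN div_less_iff_less_mult by blast
      hence "real N < real p * real C" by (metis of_nat_less_iff of_nat_mult)
      hence "1 / real p \<le> real C / real N" using \<open>p > 0\<close> N by (simp add: divide_simps mult.commute)
      hence "ln (real p) * (1 / real p) \<le> ln (real p) * (real C / real N)"
        using \<open>p > 0\<close> by (intro mult_left_mono) auto
      thus "ln (real p) / real p \<le> ln (real p) * (real C / real N)" by simp
    qed
    also have "\<dots> \<le> (\<Sum>p\<in>primes_upto N. ln (real p) * (real C / real N))"
      by (intro sum_mono2) (auto simp: primes_upto_def dest: prime_gt_0_nat)
    also have "\<dots> = theta N * (real C / real N)" by (simp add: theta_def sum_distrib_right sum_divide_distrib)
    finally have "theta N \<ge> 1 / real C * real N" using CN by (simp add: field_simps)
    moreover have "c * real N \<le> 1 / real C * real N" unfolding c_def by (intro mult_right_mono) auto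
    ultimately show ?thesis by linarith
  qed
  with c show ?thesis by blast
qed

section \<open>Mertens' second theorem\<close>

lemma abel_summation:
  fixes a v :: "nat \<Rightarrow> real"
  shows "(\<Sum>n\<le>N. a n * v n) = (\<Sum>n\<le>N. a n) * v N + (\<Sum>n<N. (\<Sum>k\<le>n. a k) * (v n - v (Suc n)))"
  by (induction N) (simp_all add: algebra_simps)

text \<open>After summation by parts the boundary term tends to 0 and the remaining series is
  dominated by a telescoping one.\<close>

lemma dirichlet_test:
  fixes a v :: "nat \<Rightarrow> real"
  assumes bnd: "\<And>N. \<bar>\<Sum>n\<le>N. a n\<bar> \<le> K" and dec: "decseq v" and lim: "v \<longlonglongrightarrow> 0"
  shows "convergent (\<lambda>N. \<Sum>n\<le>N. a n * v n)"
proof -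
  have "(\<lambda>N. (\<Sum>n\<le>N. a n) * v N) \<longlonglongrightarrow> 0"
  proof (rule Lim_null_comparison)
    show "\<forall>\<^sub>F N in sequentially. norm ((\<Sum>n\<le>N. a n) * v N) \<le> K * \<bar>v N\<bar>"
      using bnd by (auto simp: abs_mult intro!: always_eventually mult_right_mono)
    show "(\<lambda>N. K * \<bar>v N\<bar>) \<longlonglongrightarrow> 0"
      using tendsto_mult[OF tendsto_const[of K] tendsto_rabs[OF lim]] by simp
  qed
  moreover have "summable (\<lambda>n. (\<Sum>k\<le>n. a k) * (v n - v (Suc n)))"
  proof (rule summable_comparison_test')
    show "summable (\<lambda>n. K * (v n - v (Suc n)))"
      using telescope_summable'[OF lim] by (rule summable_mult)
    fix n
    have "v n - v (Suc n) \<ge> 0" using dec by (simp add: decseq_Suc_iff)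
    thus "norm ((\<Sum>k\<le>n. a k) * (v n - v (Suc n))) \<le> K * (v n - v (Suc n))"
      using bnd[of n] by (simp add: abs_mult mult_right_mono)
  qed
  hence "(\<lambda>N. \<Sum>n<N. (\<Sum>k\<le>n. a k) * (v n - v (Suc n))) \<longlonglongrightarrow> (\<Sum>n. (\<Sum>k\<le>n. a k) * (v n - v (Suc n)))"
    by (rule summable_LIMSEQ)
  ultimately have "(\<lambda>N. \<Sum>n\<le>N. a n * v n) \<longlonglongrightarrow> 0 + (\<Sum>n. (\<Sum>k\<le>n. a k) * (v n - v (Suc n)))"
    unfolding abel_summation by (rule tendsto_add)
  thus ?thesis by (auto simp: convergent_def)
qed

text \<open>The summands approximate the increments of \<open>ln (ln x)\<close> from \<open>n - 1\<close> to \<open>n\<close>: with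
  \<open>x = ln n\<close> and \<open>y = ln (n - 1)\<close> the difference is squeezed by the two elementary bounds
  \<open>1 - y / x \<le> ln (x / y) \<le> x / y - 1\<close>, whose gap is \<open>O(1 / n^2)\<close>.  The comparison starts at
  \<open>n = 3\<close>, since \<open>ln (ln 1)\<close> is only a default value.\<close>

lemma log_increment_sum_convergent:
  "convergent (\<lambda>N. (\<Sum>n\<le>N. if n \<ge> 2 then (ln (real n) - ln (real (n - 1))) / ln (real n) else 0)
                    - ln (ln (real N)))"
proof -
  let ?e = "\<lambda>n::nat. if n \<ge> 2 then (ln (real n) - ln (real (n - 1))) / ln (real n) else 0"
  define g where "g n = (if n \<ge> 3 then ?e n - (ln (ln (real n)) - ln (ln (real (n - 1)))) else 0)" for n :: nat
  have "summable g"
  proof (rule summable_comparison_test')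
    show "summable (\<lambda>n. 4 / (ln 2)\<^sup>2 * real n powr (-2))"
      by (intro summable_mult) (simp add: summable_real_powr_iff)
    fix n :: nat assume n: "n \<ge> 3"
    define x y where "x = ln (real n)" and "y = ln (real (n - 1))"
    have y: "y \<ge> ln 2" unfolding y_def using n by (subst ln_le_cancel_iff) auto
    have xy: "x \<ge> y" unfolding x_def y_def using n by (subst ln_le_cancel_iff) auto
    have l2: "ln 2 > (0::real)" by simp
    have y0: "y > 0" using y l2 by linarith
    hence x0: "x > 0" using xy by linarith
    have "x - y = ln (real n / real (n - 1))" unfolding x_def y_def using n by (simp add: ln_div)
    also have "\<dots> \<le> real n / real (n - 1) - 1" using n by (intro ln_le_minus_one) auto
    also have "\<dots> = 1 / real (n - 1)" using n by (simp add: divide_simps of_nat_diff)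
    also have "\<dots> \<le> 2 / real n" using n by (simp add: divide_simps of_nat_diff)
    finally have d: "x - y \<le> 2 / real n" .
    have gn: "g n = (1 - y / x) - ln (x / y)"
      using n x0 y0 by (simp add: g_def x_def y_def ln_div diff_divide_distrib)
    have u: "ln (x / y) \<le> x / y - 1" using x0 y0 by (intro ln_le_minus_one) auto
    have "ln (y / x) \<le> y / x - 1" using x0 y0 by (intro ln_le_minus_one) auto
    hence l: "ln (x / y) \<ge> 1 - y / x" using x0 y0 by (simp add: ln_div)
    have "norm (g n) \<le> (x / y - 1) - (1 - y / x)" using u l unfolding gn by simp
    also have "\<dots> = (x - y)\<^sup>2 / (x * y)" using x0 y0 by (simp add: field_simps power2_eq_square)
    also have "\<dots> \<le> (2 / real n)\<^sup>2 / (ln 2 * ln 2)"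
      using d xy y l2 x0 y0 by (intro frac_le power_mono mult_mono) auto
    also have "\<dots> = 4 / (ln 2)\<^sup>2 * real n powr (-2)"
      using n by (simp add: powr_minus power2_eq_square field_simps)
    finally show "norm (g n) \<le> 4 / (ln 2)\<^sup>2 * real n powr (-2)" .
  qed
  hence "(\<lambda>N. \<Sum>n\<le>N. g n) \<longlonglongrightarrow> suminf g" by (rule summable_LIMSEQ')
  hence "(\<lambda>N. (\<Sum>n\<le>N. g n) + (1 - ln (ln 2))) \<longlonglongrightarrow> suminf g + (1 - ln (ln 2))"
    by (intro tendsto_intros)
  moreover have "(\<Sum>n\<le>N. g n) + (1 - ln (ln 2)) = (\<Sum>n\<le>N. ?e n) - ln (ln (real N))" if "N \<ge> 2" for N
    using that
  proof (induction N rule: nat_induct_at_least)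
    case base
    show ?case by (simp add: numeral_2_eq_2 g_def)
  next
    case (Suc n)
    thus ?case by (simp add: g_def)
  qed
  hence "\<forall>\<^sub>F N in sequentially. (\<Sum>n\<le>N. g n) + (1 - ln (ln 2)) = (\<Sum>n\<le>N. ?e n) - ln (ln (real N))"
    by (auto simp: eventually_at_top_linorder)
  ultimately have "(\<lambda>N. (\<Sum>n\<le>N. ?e n) - ln (ln (real N))) \<longlonglongrightarrow> suminf g + (1 - ln (ln 2))"
    by (rule Lim_transform_eventually)
  thus ?thesis by (auto simp: convergent_def)
qed

lemma sum_primes_upto_conv_sum:
  fixes f :: "nat \<Rightarrow> real"
  shows "(\<Sum>p\<in>primes_upto N. f p) = (\<Sum>n\<le>N. if prime n then f n else 0)"
proof -
  have "primes_upto N = {n\<in>{..N}. prime n}" by (auto simp: primes_upto_def)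
  thus ?thesis by (simp only: sum.inter_filter finite_atMost)
qed

text \<open>Write \<open>1 / p\<close> as \<open>ln p / p\<close> weighted by \<open>1 / ln p\<close>.  Subtracting the increments of
  \<open>ln\<close> from the terms \<open>ln p / p\<close> leaves bounded partial sums by the first theorem, so the
  Dirichlet test applies to the weight \<open>1 / ln n\<close>; the subtracted part is the sum in
  \<open>log_increment_sum_convergent\<close>.\<close>

theorem mertens_second: "convergent (\<lambda>N. (\<Sum>p\<in>primes_upto N. 1 / real p) - ln (ln (real N)))"
proof -
  obtain K where K: "K \<ge> 0"
    "\<And>N. N \<ge> 1 \<Longrightarrow> \<bar>(\<Sum>p\<in>primes_upto N. ln (real p) / real p) - ln (real N)\<bar> \<le> K"
    using mertens_first by auto
  let ?L = "\<lambda>n::nat. if n \<ge> 2 then ln (real n) - ln (real (n - 1)) else 0"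
  let ?e = "\<lambda>n::nat. if n \<ge> 2 then (ln (real n) - ln (real (n - 1))) / ln (real n) else 0"
  define a where "a n = (if prime n then ln (real n) / real n else 0) - ?L n" for n :: nat
  \<comment> \<open>The maximum with 2 only avoids the values of \<open>1 / ln\<close> at 0 and 1, where \<open>a\<close> vanishes.\<close>
  define v where "v n = 1 / ln (real (max 2 n))" for n :: nat
  have L: "(\<Sum>n\<le>N. ?L n) = ln (real (max 1 N))" for N
    by (induction N) (auto simp: max_def)
  have "convergent (\<lambda>N. \<Sum>n\<le>N. a n * v n)"
  proof (rule dirichlet_test)
    fix N
    have eq: "(\<Sum>n\<le>N. a n) = (\<Sum>p\<in>primes_upto N. ln (real p) / real p) - ln (real (max 1 N))"
      unfolding a_def sum_subtractf L sum_primes_upto_conv_sum ..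
    show "\<bar>\<Sum>n\<le>N. a n\<bar> \<le> K"
    proof (cases "N \<ge> 1")
      case True thus ?thesis using K(2)[of N] unfolding eq by (simp add: max_def)
    next
      case False
      hence "N = 0" by simp
      hence "primes_upto N = {}" by (auto simp: primes_upto_def)
      thus ?thesis using K(1) \<open>N = 0\<close> unfolding eq by simp
    qed
  next
    show "decseq v" unfolding v_def decseq_def
      by (intro allI impI divide_left_mono mult_pos_pos) auto
  next
    have "filterlim (\<lambda>n. ln (real n)) at_top sequentially"
      using filterlim_compose[OF ln_at_top filterlim_real_sequentially] .
    hence "(\<lambda>n. 1 / ln (real n)) \<longlonglongrightarrow> 0"
      by (intro tendsto_divide_0[OF tendsto_const] filterlim_at_top_imp_at_infinity)
    thus "v \<longlonglongrightarrow> 0"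
      by (rule Lim_transform_eventually)
         (auto simp: v_def max_def eventually_at_top_linorder intro!: exI[of _ 3])
  qed
  moreover have "a n * v n = (if prime n then 1 / real n else 0) - ?e n" for n
    by (cases "n \<ge> 2") (auto simp: a_def v_def max_def field_simps dest: prime_ge_2_nat)
  ultimately have "convergent (\<lambda>N. (\<Sum>p\<in>primes_upto N. 1 / real p) - (\<Sum>n\<le>N. ?e n))"
    by (simp add: sum_subtractf sum_primes_upto_conv_sum)
  from convergent_add[OF this log_increment_sum_convergent]
  show ?thesis by (simp add: algebra_simps)
qed

section \<open>Finite Euler products and the zeta series\<close>

text \<open>Comparison with the integral of \<open>x powr -(1 + \<delta>)\<close>, in telescoping form: the inductive step
  is Bernoulli's inequality \<open>1 + \<delta> / x \<le> (1 - 1 / x) powr -\<delta>\<close> with \<open>x = n + 1\<close>.\<close>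

lemma zeta_partial_sum_le:
  fixes \<delta> :: real
  assumes \<delta>: "\<delta> > 0" and N: "N \<ge> 1"
  shows "(\<Sum>n=1..N. real n powr -(1 + \<delta>)) \<le> 1 + 1 / \<delta> - real N powr -\<delta> / \<delta>"
  using N
proof (induction N rule: nat_induct_at_least)
  case base
  show ?case by simp
next
  case (Suc n)
  define x r where "x = real (Suc n)" and "r = 1 - 1 / x"
  have x: "x > 1" and n_eq: "real n = x * r" and r: "r > 0"
    using Suc(1) by (auto simp: x_def r_def field_simps)
  have "ln r \<le> - (1 / x)" using r ln_le_minus_one[of r] by (simp add: r_def)
  hence "1 + \<delta> / x \<le> 1 + - \<delta> * ln r" using \<delta> mult_left_mono[of "ln r" "- (1 / x)" \<delta>] by simp
  also have "\<dots> \<le> exp (- \<delta> * ln r)" by (rule exp_ge_add_one_self)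
  also have "\<dots> = r powr -\<delta>" using r by (simp add: powr_def)
  finally have "x powr -\<delta> * (1 + \<delta> / x) \<le> x powr -\<delta> * r powr -\<delta>"
    by (intro mult_left_mono) auto
  also have "\<dots> = real n powr -\<delta>" unfolding n_eq by (simp add: powr_mult)
  finally have le: "x powr -\<delta> + \<delta> * (x powr -\<delta> / x) \<le> real n powr -\<delta>"
    by (simp add: distrib_left mult.commute)
  have "-(1 + \<delta>) = -\<delta> - 1" by simp
  hence "x powr -(1 + \<delta>) = x powr -\<delta> / x powr 1" by (simp only: powr_diff)
  hence "x powr -(1 + \<delta>) = x powr -\<delta> / x" using x by simp
  hence "\<delta> * x powr -(1 + \<delta>) \<le> real n powr -\<delta> - x powr -\<delta>" using le by simp
  hence "x powr -(1 + \<delta>) \<le> (real n powr -\<delta> - x powr -\<delta>) / \<delta>"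
    using \<delta> by (simp add: pos_le_divide_eq mult.commute)
  hence "x powr -(1 + \<delta>) \<le> real n powr -\<delta> / \<delta> - x powr -\<delta> / \<delta>"
    by (simp only: diff_divide_distrib)
  thus ?case using Suc(2) by (simp add: x_def)
qed

text \<open>Sieving the zeta series by the primes of
  \<open>P\<close> one at a time multiplies it by the factors \<open>1 - p powr -(1 + \<delta>)\<close>, and what remains still
  contains the term of \<open>n = 1\<close>.\<close>

lemma euler_product_le:
  fixes \<delta> :: real
  assumes \<delta>: "\<delta> > 0" and P: "finite P" "\<And>p. p \<in> P \<Longrightarrow> prime p"
  shows "(\<Prod>p\<in>P. 1 / (1 - real p powr -(1 + \<delta>))) \<le> 1 + 1 / \<delta>"
proof -
  define f where "f n = real n powr -(1 + \<delta>)" for n :: nat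
  define A where "A P = {n::nat. n \<ge> 1 \<and> (\<forall>p\<in>P. \<not> p dvd n)}" for P
  have summ: "f summable_on X" for X
  proof (rule summable_on_subset)
    have "summable f" unfolding f_def using \<delta> by (subst summable_real_powr_iff) auto
    thus "f summable_on UNIV" by (subst summable_on_UNIV_nonneg_real_iff) (auto simp: f_def)
  qed auto
  have f1: "f p < 1" if "prime p" for p
    unfolding f_def using that \<delta> prime_gt_1_nat[OF that] powr_less_mono[of "-(1+\<delta>)" 0 "real p"] by simp
  have sieve: "infsum f (A P) = infsum f (A {}) * (\<Prod>p\<in>P. 1 - f p)"
    using P
  proof (induction P rule: finite_induct)
    case (insert q P)
    have q: "prime q" and Pp: "\<And>p. p \<in> P \<Longrightarrow> prime p" using insert by auto
    \<comment> \<open>Multiples of \<open>q\<close> surviving the sieve by \<open>P\<close> are \<open>q\<close> times a survivor, as \<open>q \<notin> P\<close>.\<close>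
    have split: "A P = A (insert q P) \<union> (\<lambda>n. q * n) ` A P"
    proof (intro equalityI subsetI)
      fix n assume n: "n \<in> A P"
      show "n \<in> A (insert q P) \<union> (\<lambda>n. q * n) ` A P"
      proof (cases "q dvd n")
        case True
        then obtain k where "n = q * k" by (elim dvdE)
        with n have "k \<in> A P" unfolding A_def by (auto simp: Suc_le_eq)
        with \<open>n = q * k\<close> show ?thesis by blast
      qed (use n in \<open>auto simp: A_def\<close>)
    next
      fix n assume n: "n \<in> A (insert q P) \<union> (\<lambda>n. q * n) ` A P"
      show "n \<in> A P"
      proof (cases "n \<in> A (insert q P)")
        case False
        with n obtain k where k: "n = q * k" "k \<in> A P" by blast
        have "\<not> p dvd n" if "p \<in> P" for p
        proof
          assume "p dvd n"
          hence "p dvd q" using k that Pp[OF that] by (auto simp: A_def prime_dvd_mult_iff)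
          hence "p = q" using Pp[OF that] q by (simp add: primes_dvd_imp_eq)
          thus False using that insert by auto
        qed
        thus ?thesis using k q by (auto simp: A_def prime_gt_0_nat Suc_leI)
      qed (auto simp: A_def)
    qed
    have "infsum f (A P) = infsum f (A (insert q P)) + infsum f ((\<lambda>n. q * n) ` A P)"
      by (subst split, rule infsum_Un_disjoint) (auto simp: summ A_def)
    also have "infsum f ((\<lambda>n. q * n) ` A P) = infsum (\<lambda>n. f q * f n) (A P)"
      using q by (subst infsum_reindex)
        (auto simp: inj_on_def f_def powr_mult o_def prime_gt_0_nat)
    also have "\<dots> = f q * infsum f (A P)" by (rule infsum_cmult_right) (rule summ)
    finally have "infsum f (A P) = infsum f (A (insert q P)) + f q * infsum f (A P)" .
    moreover have "infsum f (A P) * (1 - f q) = infsum f (A P) - f q * infsum f (A P)"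
      by (simp add: algebra_simps)
    ultimately have "infsum f (A (insert q P)) = infsum f (A P) * (1 - f q)" by linarith
    thus ?case using insert by simp
  qed auto
  have "1 = (\<Sum>n\<in>{1}. f n)" by (simp add: f_def)
  also have "\<dots> \<le> infsum f (A P)"
    by (rule finite_sum_le_infsum[OF summ]) (use P(2)[of "Suc 0"] in \<open>auto simp: A_def f_def\<close>)
  finally have "1 \<le> infsum f (A {}) * (\<Prod>p\<in>P. 1 - f p)" unfolding sieve .
  moreover have pos: "(\<Prod>p\<in>P. 1 - f p) > 0" using P f1 by (intro prod_pos) (simp add: less_imp_le)
  ultimately have "1 / (\<Prod>p\<in>P. 1 - f p) \<le> infsum f (A {})" by (simp add: divide_le_eq)
  also have "infsum f (A {}) \<le> 1 + 1 / \<delta>"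
  proof (rule infsum_le_finite_sums[OF summ])
    fix F assume F: "finite F" "F \<subseteq> A {}"
    define N where "N = Max (insert 1 F)"
    have N: "N \<ge> 1" unfolding N_def using F by simp
    have "F \<subseteq> {1..N}" using F by (auto simp: N_def A_def)
    hence "sum f F \<le> (\<Sum>n=1..N. f n)" by (intro sum_mono2) (auto simp: f_def)
    also have "\<dots> \<le> 1 + 1 / \<delta> - real N powr -\<delta> / \<delta>"
      unfolding f_def by (rule zeta_partial_sum_le[OF \<delta> N])
    also have "\<dots> \<le> 1 + 1 / \<delta>" using \<delta> by simp
    finally show "sum f F \<le> 1 + 1 / \<delta>" .
  qed
  finally show ?thesis by (simp add: f_def prod_dividef)
qed

section \<open>The constant in Mertens' third theorem\<close>

text \<open>A one-sided Abelian theorem for Dirichlet series: an upper bound for the sums with weights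
  \<open>n powr -\<delta>\<close>, as \<open>\<delta>\<close> tends to 0, also bounds the limit of the unweighted sums.  The weights
  decrease in \<open>n\<close>, so summation by parts writes the weighted sum as an average of the partial sums.
  Those beyond a fixed \<open>N0\<close> are at least \<open>l - \<eta>\<close>, and the weight given to the earlier ones vanishes
  with \<open>\<delta>\<close>.  The hypothesis bounds long partial sums rather than the weighted series,
  because that is what a comparison with finite Euler products provides.\<close>

lemma abelian_upper_bound:
  fixes d :: "nat \<Rightarrow> real" and U :: "real \<Rightarrow> real"
  assumes lim: "(\<lambda>N. \<Sum>n\<le>N. d n) \<longlonglongrightarrow> l"
    and bound: "\<And>\<delta> e. \<delta> > 0 \<Longrightarrow> e > 0 \<Longrightarrow>
          \<forall>\<^sub>F N in sequentially. (\<Sum>n\<le>N. d n * real (max 1 n) powr -\<delta>) \<le> U \<delta> + e"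
    and U: "(U \<longlongrightarrow> u) (at_right 0)"
  shows "l \<le> u"
proof (rule field_le_epsilon)
  fix \<eta> :: real assume \<eta>: "\<eta> > 0"
  let ?D = "\<lambda>N. \<Sum>n\<le>N. d n"
  obtain K where K: "K > 0" "\<And>N. \<bar>?D N\<bar> \<le> K"
    using convergent_imp_Bseq[OF convergentI[OF lim]] unfolding Bseq_def real_norm_def by blast
  obtain N0 where N0: "\<And>N. N \<ge> N0 \<Longrightarrow> ?D N \<ge> l - \<eta>"
    using order_tendstoD(1)[OF lim, of "l - \<eta>"] \<eta>
    by (auto simp: eventually_at_top_linorder intro: less_imp_le)
  \<comment> \<open>The maximum with 1 makes the weights decrease from the index 0 on.\<close>
  define w where "w \<delta> n = real (max 1 n) powr -\<delta>" for \<delta> :: real and n :: nat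
  define L where "L \<delta> = -K * (1 - w \<delta> N0) + (l - \<eta>) * w \<delta> N0" for \<delta>
  have LU: "L \<delta> \<le> U \<delta>" if \<delta>: "\<delta> > 0" for \<delta>
  proof (rule field_le_epsilon)
    fix e :: real assume e: "e > 0"
    obtain N1 where N1: "\<And>N. N \<ge> N1 \<Longrightarrow> (\<Sum>n\<le>N. d n * w \<delta> n) \<le> U \<delta> + e"
      using bound[OF \<delta> e] unfolding w_def by (auto simp: eventually_at_top_linorder)
    define N where "N = max N0 N1"
    have N: "N \<ge> N0" "N \<ge> N1" by (auto simp: N_def)
    have dec: "w \<delta> n - w \<delta> (Suc n) \<ge> 0" for n
      unfolding w_def using \<delta> by (simp add: powr_mono2')
    have tele: "(\<Sum>n<m. w \<delta> n - w \<delta> (Suc n)) = w \<delta> 0 - w \<delta> m" for m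
      by (rule sum_lessThan_telescope')
    have "-K * (1 - w \<delta> N0) = (\<Sum>n<N0. -K * (w \<delta> n - w \<delta> (Suc n)))"
      unfolding sum_distrib_left[symmetric] tele by (simp add: w_def)
    also have "\<dots> \<le> (\<Sum>n<N0. ?D n * (w \<delta> n - w \<delta> (Suc n)))"
      using K(2) by (intro sum_mono mult_right_mono dec) (simp add: abs_le_iff minus_le_iff)
    finally have 1: "-K * (1 - w \<delta> N0) \<le> (\<Sum>n<N0. ?D n * (w \<delta> n - w \<delta> (Suc n)))" .
    have un: "{..<N} = {..<N0} \<union> {N0..<N}" using N by auto
    have spl: "(\<Sum>n<N. h n) = (\<Sum>n<N0. h n) + (\<Sum>n=N0..<N. h n)" for h :: "nat \<Rightarrow> real"
      unfolding un by (rule sum.union_disjoint) auto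
    have "(l - \<eta>) * (w \<delta> N0 - w \<delta> N) = (\<Sum>n=N0..<N. (l - \<eta>) * (w \<delta> n - w \<delta> (Suc n)))"
      using spl[of "\<lambda>n. w \<delta> n - w \<delta> (Suc n)"] unfolding tele by (simp add: sum_distrib_left[symmetric])
    also have "\<dots> \<le> (\<Sum>n=N0..<N. ?D n * (w \<delta> n - w \<delta> (Suc n)))"
      using N0 by (intro sum_mono mult_right_mono dec) auto
    finally have 2: "(l - \<eta>) * (w \<delta> N0 - w \<delta> N) \<le> (\<Sum>n=N0..<N. ?D n * (w \<delta> n - w \<delta> (Suc n)))" .
    have 3: "(l - \<eta>) * w \<delta> N \<le> ?D N * w \<delta> N"
      using N0[OF N(1)] by (intro mult_right_mono) (auto simp: w_def)
    have "L \<delta> \<le> (\<Sum>n\<le>N. d n * w \<delta> n)"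
      unfolding abel_summation spl L_def using 1 2 3 by (simp add: algebra_simps)
    also have "\<dots> \<le> U \<delta> + e" using N1[OF N(2)] .
    finally show "L \<delta> \<le> U \<delta> + e" .
  qed
  have w1: "((\<lambda>\<delta>. w \<delta> N0) \<longlongrightarrow> 1) (at_right 0)"
  proof -
    have "((\<lambda>\<delta>. real (max 1 N0) powr -\<delta>) \<longlongrightarrow> real (max 1 N0) powr -0) (at_right 0)"
      by (intro tendsto_intros) auto
    thus ?thesis by (simp add: w_def)
  qed
  have "(L \<longlongrightarrow> -K * (1 - 1) + (l - \<eta>) * 1) (at_right 0)"
    unfolding L_def by (intro tendsto_intros w1)
  hence "l - \<eta> \<le> u"
    using tendsto_le[OF trivial_limit_at_right_real U, of L "l - \<eta>"] LU
    by (auto simp: eventually_at_right_less intro: eventually_mono[OF eventually_at_right_less])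
  thus "l \<le> u + \<eta>" by simp
qed

text \<open>The harmonic series moved to the powers of two: the term \<open>1 / k\<close> sits at \<open>2 ^ k\<close>.  Its partial
  sums grow like \<open>ln (ln N)\<close>, as those of the prime reciprocals do, but here both the constant term
  and the Dirichlet series are explicit.  The latter is the logarithmic series at
  \<open>2 powr -\<delta>\<close>.\<close>

definition dyadic_harmonic :: "nat \<Rightarrow> real" where
  "dyadic_harmonic n = (if n \<ge> 2 \<and> n = 2 ^ floor_log n then 1 / real (floor_log n) else 0)"

lemma sum_dyadic_harmonic:
  fixes g :: "nat \<Rightarrow> real"
  assumes "N \<ge> 1"
  shows "(\<Sum>n\<le>N. dyadic_harmonic n * g n) = (\<Sum>k=1..floor_log N. g (2 ^ k) / real k)"
proof -
  have "(\<Sum>k=1..floor_log N. g (2 ^ k) / real k) = (\<Sum>k=1..floor_log N. dyadic_harmonic (2 ^ k) * g (2 ^ k))"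
  proof (intro sum.cong refl)
    fix k assume "k \<in> {1..floor_log N}"
    hence "(2::nat) ^ 1 \<le> 2 ^ k" by (intro power_increasing) auto
    thus "g (2 ^ k) / real k = dyadic_harmonic (2 ^ k) * g (2 ^ k)"
      by (simp add: dyadic_harmonic_def)
  qed
  also have "\<dots> = (\<Sum>n\<in>(\<lambda>k. 2 ^ k) ` {1..floor_log N}. dyadic_harmonic n * g n)"
    by (subst sum.reindex) (auto simp: inj_on_def)
  also have "\<dots> = (\<Sum>n\<le>N. dyadic_harmonic n * g n)"
  proof (rule sum.mono_neutral_left)
    show "(\<lambda>k. 2 ^ k) ` {1..floor_log N} \<subseteq> {..N}"
    proof safe
      fix k assume "k \<in> {1..floor_log N}"
      hence "(2::nat) ^ k \<le> 2 ^ floor_log N" by (intro power_increasing) auto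
      also have "\<dots> \<le> N" using floor_log_exp2_le[of N] assms by simp
      finally show "2 ^ k \<le> N" by simp
    qed
    show "\<forall>n\<in>{..N} - (\<lambda>k. 2 ^ k) ` {1..floor_log N}. dyadic_harmonic n * g n = 0"
    proof
      fix n assume n: "n \<in> {..N} - (\<lambda>k. 2 ^ k) ` {1..floor_log N}"
      show "dyadic_harmonic n * g n = 0"
      proof (cases "n \<ge> 2 \<and> n = 2 ^ floor_log n")
        case True
        have "floor_log n \<ge> 1" using True by (subst floor_log_rec) auto
        moreover have "floor_log n \<le> floor_log N" using n by (intro floor_log_le_iff) auto
        ultimately have "n \<in> (\<lambda>k. 2 ^ k) ` {1..floor_log N}" using True by auto
        with n show ?thesis by simp
      qed (auto simp: dyadic_harmonic_def)
    qed
  qed auto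
  finally show ?thesis ..
qed

lemma filterlim_floor_log: "filterlim floor_log at_top at_top"
proof (subst filterlim_at_top, intro allI)
  fix k :: nat
  show "\<forall>\<^sub>F N in at_top. k \<le> floor_log N"
    using eventually_ge_at_top[of "2 ^ k :: nat"]
  proof eventually_elim
    case (elim N)
    thus ?case using floor_log_le_iff[OF elim] by simp
  qed
qed

text \<open>This is where Euler's constant enters: up to \<open>N\<close> the sum is the harmonic number of
  \<open>floor (log 2 N)\<close>.\<close>

lemma dyadic_harmonic_asymp:
  "(\<lambda>N. (\<Sum>n\<le>N. dyadic_harmonic n) - ln (ln (real N))) \<longlonglongrightarrow> euler_mascheroni - ln (ln 2)"
proof -
  have 1: "(\<lambda>N. harm (floor_log N) - ln (real (floor_log N))) \<longlonglongrightarrow> (euler_mascheroni :: real)"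
    by (rule filterlim_compose[OF euler_mascheroni_LIMSEQ filterlim_floor_log])
  have lim: "(\<lambda>N. 1 + 1 / real (floor_log N)) \<longlonglongrightarrow> 1 + 0"
    by (intro tendsto_add tendsto_const filterlim_compose[OF lim_1_over_n filterlim_floor_log])
  have "(\<lambda>N. (ln (real N) / ln 2) / real (floor_log N)) \<longlonglongrightarrow> 1"
  proof (rule tendsto_sandwich[OF _ _ tendsto_const])
    show "(\<lambda>N. 1 + 1 / real (floor_log N)) \<longlonglongrightarrow> 1" using lim by simp
    have ev: "\<forall>\<^sub>F N in sequentially. N \<ge> 2" by (rule eventually_ge_at_top)
    have fl: "real (floor_log N) \<le> ln (real N) / ln 2" "ln (real N) / ln 2 \<le> real (floor_log N) + 1"
         "real (floor_log N) > 0" if "N \<ge> 2" for N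
    proof -
      have N: "real N > 0" "N > 0" using that by auto
      have "real (2 ^ floor_log N) \<le> real N" using floor_log_exp2_le[OF N(2)] by (simp only: of_nat_le_iff)
      hence "ln (2 ^ floor_log N) \<le> ln (real N)" using N by (subst ln_le_cancel_iff) auto
      thus "real (floor_log N) \<le> ln (real N) / ln 2" by (simp add: ln_realpow pos_le_divide_eq)
      have "real N \<le> real (2 * 2 ^ floor_log N)" using floor_log_exp2_ge[of N] by (simp only: of_nat_le_iff)
      hence "ln (real N) \<le> ln (2 ^ Suc (floor_log N))" using N by (subst ln_le_cancel_iff) auto
      hence "ln (real N) \<le> real (Suc (floor_log N)) * ln 2" by (simp only: ln_realpow zero_less_numeral)
      thus "ln (real N) / ln 2 \<le> real (floor_log N) + 1" by (simp add: pos_divide_le_eq add.commute)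
      show "real (floor_log N) > 0" using that by (subst floor_log_rec) auto
    qed
    show "\<forall>\<^sub>F N in sequentially. 1 \<le> (ln (real N) / ln 2) / real (floor_log N)"
      using ev by eventually_elim (use fl in \<open>simp only: pos_le_divide_eq mult_1\<close>)
    show "\<forall>\<^sub>F N in sequentially. (ln (real N) / ln 2) / real (floor_log N) \<le> 1 + 1 / real (floor_log N)"
      using ev
    proof eventually_elim
      case (elim N)
      have "1 + 1 / real (floor_log N) = (real (floor_log N) + 1) / real (floor_log N)"
        using fl(3)[OF elim] by (simp add: add_divide_distrib)
      thus ?case using fl[OF elim] by (simp only: divide_right_mono less_imp_le)
    qed
  qed
  hence "(\<lambda>N. ln ((ln (real N) / ln 2) / real (floor_log N))) \<longlonglongrightarrow> ln 1"
    by (intro tendsto_ln) auto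
  hence 2: "(\<lambda>N. harm (floor_log N) - ln (real (floor_log N)) - ln ((ln (real N) / ln 2) / real (floor_log N)) - ln (ln 2))
      \<longlonglongrightarrow> euler_mascheroni - ln 1 - ln (ln 2)"
    by (intro tendsto_diff 1 tendsto_const)
  have "\<forall>\<^sub>F N in sequentially. harm (floor_log N) - ln (real (floor_log N)) - ln ((ln (real N) / ln 2) / real (floor_log N)) - ln (ln 2)
      = (\<Sum>n\<le>N. dyadic_harmonic n) - ln (ln (real N))"
    using eventually_ge_at_top[of 2]
  proof eventually_elim
    case (elim N)
    have "floor_log N > 0" using elim by (subst floor_log_rec) auto
    hence pos: "ln (real N) > 0" "ln 2 > (0::real)" "real (floor_log N) > 0" using elim by auto
    have "(\<Sum>n\<le>N. dyadic_harmonic n) = harm (floor_log N)"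
      using sum_dyadic_harmonic[of N "\<lambda>_. 1"] elim by (simp add: harm_def inverse_eq_divide)
    moreover have "ln ((ln (real N) / ln 2) / real (floor_log N)) = ln (ln (real N)) - ln (ln 2) - ln (real (floor_log N))"
      using pos by (subst ln_div, simp_all, subst ln_div, simp_all)
    ultimately show ?case by simp
  qed
  from Lim_transform_eventually[OF 2 this] show ?thesis by simp
qed

text \<open>Let \<open>d\<close> be the difference of the prime reciprocals and the dyadic harmonic series.  Its partial
  sums converge to \<open>M - \<gamma> + ln (ln 2)\<close>.  Weighted by \<open>n powr -\<delta>\<close>, they are eventually bounded, up to any
  \<open>e > 0\<close>, by the logarithm
  of the zeta bound \<open>1 + 1 / \<delta>\<close>, minus the contribution \<open>E\<close> of higher prime powers, plus
  \<open>ln (1 - 2 powr -\<delta>)\<close>; as \<open>\<delta>\<close> tends to 0 the two logarithms combine to \<open>ln (ln 2)\<close>, which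
  cancels.  Keeping only the prime powers of primes up to \<open>P\<close> in \<open>E\<close> makes it a finite sum, so
  that its continuity at 0 is immediate.\<close>

lemma mertens_constant_le:
  assumes M: "(\<lambda>N. (\<Sum>p\<in>primes_upto N. 1 / real p) - ln (ln (real N))) \<longlonglongrightarrow> M"
  shows "M + (\<Sum>p\<in>primes_upto P. - ln (1 - 1 / real p) - 1 / real p) \<le> euler_mascheroni"
proof -
  define d where "d n = (if prime n then 1 / real n else 0) - dyadic_harmonic n" for n
  define x where "x \<delta> p = real p powr -(1 + \<delta>)" for \<delta> :: real and p :: nat
  define E where "E \<delta> = (\<Sum>p\<in>primes_upto P. - ln (1 - x \<delta> p) - x \<delta> p)" for \<delta> :: real
  define U where "U \<delta> = ln (1 + 1 / \<delta>) - E \<delta> + ln (1 - 2 powr -\<delta>)" for \<delta> :: real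
  have "M - (euler_mascheroni - ln (ln 2)) \<le> ln (ln 2) - E 0"
  proof (rule abelian_upper_bound)
    show "(\<lambda>N. \<Sum>n\<le>N. d n) \<longlonglongrightarrow> M - (euler_mascheroni - ln (ln 2))"
      using tendsto_diff[OF M dyadic_harmonic_asymp]
      by (simp add: d_def sum_subtractf sum_primes_upto_conv_sum)
  next
    fix \<delta> e :: real assume \<delta>: "\<delta> > 0" and e: "e > 0"
    have x1: "0 < x \<delta> p" "x \<delta> p < 1" if "prime p" for p
      unfolding x_def using that \<delta> prime_gt_1_nat[OF that] powr_less_mono[of "-(1+\<delta>)" 0 "real p"]
      by auto
    have prime_part: "(\<Sum>p\<in>primes_upto N. x \<delta> p) \<le> ln (1 + 1 / \<delta>) - E \<delta>" if N: "N \<ge> P" for N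
    proof -
      have xN: "1 - x \<delta> p > 0" if "p \<in> primes_upto N" for p
        using x1 that by (simp add: primes_upto_def)
      have "(\<Sum>p\<in>primes_upto N. - ln (1 - x \<delta> p)) = (\<Sum>p\<in>primes_upto N. ln (1 / (1 - x \<delta> p)))"
        using xN by (intro sum.cong refl) (simp add: ln_div)
      also have "\<dots> = ln (\<Prod>p\<in>primes_upto N. 1 / (1 - x \<delta> p))"
        by (rule ln_prod[symmetric]) (use xN in force)+
      also have "\<dots> \<le> ln (1 + 1 / \<delta>)"
      proof (rule ln_mono)
        show "0 < (\<Prod>p\<in>primes_upto N. 1 / (1 - x \<delta> p))" using xN by (intro prod_pos) auto
        show "(\<Prod>p\<in>primes_upto N. 1 / (1 - x \<delta> p)) \<le> 1 + 1 / \<delta>"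
          unfolding x_def by (rule euler_product_le[OF \<delta>]) (auto simp: primes_upto_def)
      qed
      finally have 1: "(\<Sum>p\<in>primes_upto N. - ln (1 - x \<delta> p)) \<le> ln (1 + 1 / \<delta>)" .
      have "E \<delta> \<le> (\<Sum>p\<in>primes_upto N. - ln (1 - x \<delta> p) - x \<delta> p)"
        unfolding E_def
      proof (rule sum_mono2)
        fix p assume "p \<in> primes_upto N - primes_upto P"
        hence "0 < x \<delta> p" "x \<delta> p < 1" using x1 by (auto simp: primes_upto_def)
        thus "0 \<le> - ln (1 - x \<delta> p) - x \<delta> p" using ln_le_minus_one[of "1 - x \<delta> p"] by simp
      qed (use N primes_upto_mono in auto)
      thus ?thesis using 1 by (simp add: sum_subtractf)
    qed
    define r where "r = 2 powr -\<delta>"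
    have r: "0 < r" "r < 1" unfolding r_def using \<delta> powr_less_mono[of "-\<delta>" 0 2] by auto
    have "(\<lambda>n. - (r ^ n) / real n) sums ln (1 - r)" using ln_series'[of "-r"] r by simp
    hence "(\<lambda>L. \<Sum>k\<le>L. - (r ^ k) / real k) \<longlonglongrightarrow> ln (1 - r)" by (simp add: sums_def_le)
    hence "(\<lambda>N. \<Sum>k\<le>floor_log N. - (r ^ k) / real k) \<longlonglongrightarrow> ln (1 - r)"
      by (rule filterlim_compose[OF _ filterlim_floor_log])
    hence "\<forall>\<^sub>F N in sequentially. (\<Sum>k\<le>floor_log N. - (r ^ k) / real k) < ln (1 - r) + e"
      by (rule order_tendstoD) (use e in auto)
    thus "\<forall>\<^sub>F N in sequentially. (\<Sum>n\<le>N. d n * real (max 1 n) powr -\<delta>) \<le> U \<delta> + e"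
      using eventually_ge_at_top[of P] eventually_ge_at_top[of 1]
    proof eventually_elim
      case (elim N)
      have pp: "(if prime n then 1 / real n else 0) * real (max 1 n) powr -\<delta> = (if prime n then x \<delta> n else 0)" for n
        using prime_gt_0_nat[of n] powr_add[of "real n" "-1" "-\<delta>"]
        by (auto simp: x_def max_def powr_minus_divide)
      have "(\<Sum>n\<le>N. dyadic_harmonic n * real (max 1 n) powr -\<delta>)
            = (\<Sum>k=1..floor_log N. real (max 1 (2 ^ k)) powr -\<delta> / real k)"
        by (rule sum_dyadic_harmonic) (use elim in auto)
      also have "\<dots> = (\<Sum>k=1..floor_log N. r ^ k / real k)"
      proof (intro sum.cong refl)
        fix k :: nat
        have "real (max 1 (2 ^ k)) = 2 powr real k" by (simp add: powr_realpow max_def)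
        thus "real (max 1 (2 ^ k)) powr -\<delta> / real k = r ^ k / real k"
          by (simp add: r_def powr_powr powr_realpow[symmetric] mult.commute)
      qed
      also have "\<dots> = (\<Sum>k\<le>floor_log N. r ^ k / real k)"
        by (rule sum.mono_neutral_left) auto
      finally have "(\<Sum>n\<le>N. d n * real (max 1 n) powr -\<delta>)
          = (\<Sum>p\<in>primes_upto N. x \<delta> p) + (\<Sum>k\<le>floor_log N. - (r ^ k) / real k)"
        unfolding d_def left_diff_distrib pp sum_subtractf sum_primes_upto_conv_sum
        by (simp add: sum_negf)
      thus ?case using elim prime_part[of N] by (simp add: U_def r_def)
    qed
  next
    have E: "(E \<longlongrightarrow> E 0) (at_right 0)"
      unfolding E_def x_def
    proof (rule tendsto_sum)
      fix p assume "p \<in> primes_upto P"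
      hence p: "real p \<noteq> 0" "1 - real p powr -(1 + 0) \<noteq> 0"
        using primes_upto_ge_2[of p P] by (auto simp: powr_minus field_simps)
      show "((\<lambda>\<delta>. - ln (1 - real p powr -(1 + \<delta>)) - real p powr -(1 + \<delta>)) \<longlongrightarrow>
              - ln (1 - real p powr -(1 + 0)) - real p powr -(1 + 0)) (at_right 0)"
        by (intro tendsto_intros) (use p in auto)
    qed
    \<comment> \<open>\<open>(1 - 2 powr -\<delta>) / \<delta>\<close> is a difference quotient and tends to \<open>ln 2\<close>.\<close>
    have "((\<lambda>\<delta>::real. 2 powr -\<delta>) has_real_derivative - ln 2) (at 0)"
      by (auto intro!: derivative_eq_intros)
    hence "((\<lambda>\<delta>::real. (2 powr -\<delta> - 1) / \<delta>) \<longlongrightarrow> - ln 2) (at 0)"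
      by (simp add: has_field_derivative_iff)
    hence "((\<lambda>\<delta>::real. (2 powr -\<delta> - 1) / \<delta>) \<longlongrightarrow> - ln 2) (at_right 0)"
      by (rule filterlim_mono) (auto simp: at_within_le_at)
    hence "((\<lambda>\<delta>::real. ln ((1 + \<delta>) * - ((2 powr -\<delta> - 1) / \<delta>))) \<longlongrightarrow> ln ((1 + 0) * - (- ln 2))) (at_right 0)"
      by (intro tendsto_intros) auto
    hence "((\<lambda>\<delta>::real. ln ((1 + \<delta>) * - ((2 powr -\<delta> - 1) / \<delta>)) - E \<delta>) \<longlongrightarrow> ln ((1 + 0) * - (- ln 2)) - E 0) (at_right 0)"
      by (intro tendsto_diff E)
    moreover have "\<forall>\<^sub>F \<delta> in at_right 0. ln ((1 + \<delta>) * - ((2 powr -\<delta> - 1) / \<delta>)) - E \<delta> = U \<delta>"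
      using eventually_at_right_less[of "0::real"]
    proof eventually_elim
      case (elim \<delta>)
      have "2 powr -\<delta> < (1::real)" using elim powr_less_mono[of "-\<delta>" 0 2] by simp
      moreover have "(1 + \<delta>) * - ((2 powr -\<delta> - 1) / \<delta>) = (1 + 1 / \<delta>) * (1 - 2 powr -\<delta>)"
        using elim by (simp add: field_simps)
      moreover have "1 + 1 / \<delta> > 0" using elim by (simp add: add_pos_pos)
      ultimately show ?case by (simp only: U_def ln_mult_pos diff_gt_0_iff_gt)
    qed
    ultimately show "(U \<longlongrightarrow> ln (ln 2) - E 0) (at_right 0)"
      using Lim_transform_eventually by force
  qed
  moreover have "E 0 = (\<Sum>p\<in>primes_upto P. - ln (1 - 1 / real p) - 1 / real p)"
    unfolding E_def x_def by (intro sum.cong) (auto simp: powr_minus_divide)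
  ultimately show ?thesis by simp
qed

text \<open>The upper half of Mertens' third theorem: the logarithm of the product is the sum of the
  prime reciprocals plus the contribution of higher prime powers, and \<open>mertens_constant_le\<close> bounds the
  resulting constant by Euler's.\<close>

theorem mertens_third_upper:
  assumes \<eta>: "\<eta> > 0"
  shows "\<forall>\<^sub>F N in sequentially.
           (\<Prod>p\<in>primes_upto N. 1 / (1 - 1 / real p)) \<le> (1 + \<eta>) * exp euler_mascheroni * ln (real N)"
proof -
  obtain M where M: "(\<lambda>N. (\<Sum>p\<in>primes_upto N. 1 / real p) - ln (ln (real N))) \<longlonglongrightarrow> M"
    using mertens_second by (auto simp: convergent_def)
  have "\<forall>\<^sub>F N in sequentially. (\<Sum>p\<in>primes_upto N. 1 / real p) - ln (ln (real N)) < M + ln (1 + \<eta>)"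
    by (rule order_tendstoD[OF M]) (use \<eta> in auto)
  thus ?thesis using eventually_ge_at_top[of 2]
  proof eventually_elim
    case (elim N)
    have p: "real p \<ge> 2" if "p \<in> primes_upto N" for p using primes_upto_ge_2[OF that] by simp
    have pos: "1 - 1 / real p > 0" if "p \<in> primes_upto N" for p using p[OF that] by simp
    have "(\<Prod>p\<in>primes_upto N. 1 / (1 - 1 / real p)) = exp (\<Sum>p\<in>primes_upto N. - ln (1 - 1 / real p))"
      using pos by (simp add: exp_sum exp_minus inverse_eq_divide)
    also have "\<dots> \<le> exp (ln (1 + \<eta>) + euler_mascheroni + ln (ln (real N)))"
      using mertens_constant_le[OF M, of N] elim by (simp add: sum_subtractf)
    also have "\<dots> = (1 + \<eta>) * exp euler_mascheroni * ln (real N)"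
      using elim \<eta> by (simp add: exp_add)
    finally show ?case .
  qed
qed

section \<open>The enumeration of the primes\<close>

lemma prime_nth_prime: "prime (nth_prime k)"
  using enumerate_in_set[OF primes_infinite, of "k - 1"] by (simp add: nth_prime_def)

lemma nth_prime_less: "1 \<le> i \<Longrightarrow> i < k \<Longrightarrow> nth_prime i < nth_prime k"
  unfolding nth_prime_def by (rule enumerate_mono[OF _ primes_infinite]) simp

lemma nth_prime_le: "1 \<le> i \<Longrightarrow> i \<le> k \<Longrightarrow> nth_prime i \<le> nth_prime k"
  using nth_prime_less[of i k] by (cases "i = k") auto

lemma le_nth_prime: "k \<le> nth_prime k + 1"
  using le_enumerate[OF primes_infinite, of "k - 1"] by (simp add: nth_prime_def)

lemma nth_prime_ge_2: "real (nth_prime k) \<ge> 2"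
  using prime_ge_2_nat[OF prime_nth_prime[of k]] by simp

lemma bij_betw_nth_prime:
  assumes "m \<ge> 1"
  shows "bij_betw nth_prime {1..m} (primes_upto (nth_prime m))"
proof (rule bij_betwI')
  fix i k assume "i \<in> {1..m}" "k \<in> {1..m}"
  thus "(nth_prime i = nth_prime k) = (i = k)"
    using nth_prime_less[of i k] nth_prime_less[of k i] by (cases i k rule: linorder_cases) auto
next
  fix i assume "i \<in> {1..m}"
  thus "nth_prime i \<in> primes_upto (nth_prime m)"
    by (simp add: primes_upto_def prime_nth_prime nth_prime_le)
next
  fix p assume p: "p \<in> primes_upto (nth_prime m)"
  then obtain i where "enumerate {p. prime p} i = p"
    using enumerate_Ex[OF primes_infinite, of p] by (auto simp: primes_upto_def)
  hence i: "nth_prime (Suc i) = p" by (simp add: nth_prime_def)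
  have "\<not> m < Suc i"
  proof
    assume "m < Suc i"
    from nth_prime_less[OF assms this] p i show False by (simp add: primes_upto_def)
  qed
  with i show "\<exists>k\<in>{1..m}. p = nth_prime k" by (intro bexI[of _ "Suc i"]) auto
qed

lemma theta_nth_prime:
  assumes "m \<ge> 1"
  shows "theta (nth_prime m) = (\<Sum>k=1..m. ln (real (nth_prime k)))"
  unfolding theta_def using sum.reindex_bij_betw[OF bij_betw_nth_prime[OF assms], of "\<lambda>p. ln (real p)"]
  by simp

text \<open>Let \<open>p\<close> be the \<open>m\<close>-th prime.  By Chebyshev's lower bound
  \<open>c p \<le> m ln p \<le> 2 m sqrt p\<close>, so \<open>ln p \<le> 2 sqrt p \<le> 4 m / c\<close>.\<close>

lemma ln_nth_prime_le: "\<exists>C>0. \<forall>m\<ge>1. ln (real (nth_prime m)) \<le> C * real m"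
proof -
  obtain c where c: "c > 0" "\<And>N. N \<ge> 2 \<Longrightarrow> theta N \<ge> c * real N"
    using chebyshev_theta_lower by auto
  have "ln (real (nth_prime m)) \<le> 4 / c * real m" if m: "m \<ge> 1" for m
  proof -
    define x where "x = sqrt (real (nth_prime m))"
    have x: "x > 0" "x * x = real (nth_prime m)"
      unfolding x_def using nth_prime_ge_2[of m] by auto
    have "ln (real (nth_prime m)) = 2 * ln x" using x by (simp add: ln_mult flip: x(2))
    also have "\<dots> \<le> 2 * x" using ln_le_minus_one[OF x(1)] by simp
    finally have l: "ln (real (nth_prime m)) \<le> 2 * x" .
    have "c * (x * x) \<le> theta (nth_prime m)"
      using c(2)[of "nth_prime m"] prime_ge_2_nat[OF prime_nth_prime[of m]] x by simp
    also have "\<dots> \<le> (\<Sum>k=1..m. ln (real (nth_prime m)))"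
      unfolding theta_nth_prime[OF m]
    proof (rule sum_mono)
      fix k assume "k \<in> {1..m}"
      thus "ln (real (nth_prime k)) \<le> ln (real (nth_prime m))"
        using nth_prime_le[of k m] nth_prime_ge_2[of k] by (subst ln_le_cancel_iff) auto
    qed
    also have "\<dots> = real m * ln (real (nth_prime m))" by simp
    also have "\<dots> \<le> real m * (2 * x)" using l by (intro mult_left_mono) auto
    finally have "(c * x) * x \<le> (2 * real m) * x" by (simp add: algebra_simps)
    hence "c * x \<le> 2 * real m" using x(1) by simp
    hence "2 * x \<le> 4 / c * real m" using c(1) by (simp add: field_simps)
    with l show ?thesis by linarith
  qed
  with c(1) show ?thesis by (intro exI[of _ "4 / c"]) auto
qed

section \<open>The sum of divisors\<close>

text \<open>Every divisor of \<open>a b\<close> is a product of a divisor of \<open>a\<close> and one of \<open>b\<close>.\<close>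

lemma divisor_sum_mult_le:
  assumes "a > 0" "b > 0"
  shows "divisor_sum (a * b) \<le> divisor_sum a * divisor_sum b"
proof -
  let ?D = "\<lambda>n::nat. {d. d dvd n}"
  have fin: "finite (?D a \<times> ?D b)" using assms by auto
  have "?D (a * b) \<subseteq> (\<lambda>(x, y). x * y) ` (?D a \<times> ?D b)"
  proof
    fix d assume "d \<in> ?D (a * b)"
    then obtain x y where "d = x * y" "x dvd a" "y dvd b" using division_decomp by blast
    thus "d \<in> (\<lambda>(x, y). x * y) ` (?D a \<times> ?D b)" by (intro image_eqI[of _ _ "(x, y)"]) auto
  qed
  hence "divisor_sum (a * b) \<le> (\<Sum>d\<in>(\<lambda>(x, y). x * y) ` (?D a \<times> ?D b). d)"
    unfolding divisor_sum_def using fin by (intro sum_mono2 finite_imageI) auto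
  also have "\<dots> \<le> (\<Sum>z\<in>?D a \<times> ?D b. case z of (x, y) \<Rightarrow> x * y)"
    using sum_image_le[OF fin, of "\<lambda>d. d" "\<lambda>(x, y). x * y"] by (simp add: o_def)
  also have "\<dots> = divisor_sum a * divisor_sum b"
    unfolding divisor_sum_def by (simp add: sum_product sum.cartesian_product)
  finally show ?thesis .
qed

lemma divisor_sum_prod_le:
  assumes "finite S" "\<And>k. k \<in> S \<Longrightarrow> f k > 0"
  shows "divisor_sum (\<Prod>k\<in>S. f k) \<le> (\<Prod>k\<in>S. divisor_sum (f k))"
  using assms
proof (induction S rule: finite_induct)
  case empty
  show ?case by (simp add: divisor_sum_def)
next
  case (insert k S)
  have "divisor_sum (f k * (\<Prod>k\<in>S. f k)) \<le> divisor_sum (f k) * divisor_sum (\<Prod>k\<in>S. f k)"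
    using insert by (intro divisor_sum_mult_le prod_pos) auto
  also have "\<dots> \<le> divisor_sum (f k) * (\<Prod>k\<in>S. divisor_sum (f k))"
    using insert by (intro mult_left_mono) auto
  finally show ?case using insert by simp
qed

lemma divisor_sum_prime_power:
  assumes p: "prime p"
  shows "real (divisor_sum (p ^ a)) = real (p ^ a) * ((1 - (1 / real p) ^ Suc a) / (1 - 1 / real p))"
proof -
  have p1: "p > 1" using p by (rule prime_gt_1_nat)
  have "{d. d dvd p ^ a} = (\<lambda>i. p ^ i) ` {..a}" using divides_primepow_nat[OF p] by auto
  hence "divisor_sum (p ^ a) = (\<Sum>i\<le>a. p ^ i)"
    unfolding divisor_sum_def using p1 by (simp add: sum.reindex inj_on_def)
  moreover have "(\<Sum>i\<le>a. real p ^ i) = real p ^ a * ((1 - (1 / real p) ^ Suc a) / (1 - 1 / real p))"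
  proof -
    have "(real p - 1) * (\<Sum>i\<le>a. real p ^ i) = real p ^ Suc a - 1"
      by (induction a) (simp_all add: algebra_simps)
    hence "(\<Sum>i\<le>a. real p ^ i) = (real p ^ Suc a - 1) / (real p - 1)"
      using p1 by (simp add: eq_divide_eq mult.commute)
    also have "real p ^ Suc a - 1 = real p * (real p ^ a * (1 - (1 / real p) ^ Suc a))"
      using p1 by (simp add: power_divide right_diff_distrib)
    also have "real p - 1 = real p * (1 - 1 / real p)" using p1 by (simp add: right_diff_distrib)
    finally show ?thesis using p1 by simp
  qed
  ultimately show ?thesis by simp
qed

lemma divisor_sum_prime_product_le:
  fixes a :: "nat \<Rightarrow> nat"
  assumes m: "m \<ge> 1"
  defines "n \<equiv> \<Prod>k=1..m. nth_prime k ^ a k"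
  shows "real (divisor_sum n) \<le> real n * ((\<Prod>k=1..m. 1 - (1 / real (nth_prime k)) ^ Suc (a k))
           * (\<Prod>p\<in>primes_upto (nth_prime m). 1 / (1 - 1 / real p)))"
proof -
  have "divisor_sum n \<le> (\<Prod>k=1..m. divisor_sum (nth_prime k ^ a k))"
    unfolding n_def by (rule divisor_sum_prod_le) (auto simp: prime_gt_0_nat prime_nth_prime)
  hence "real (divisor_sum n) \<le> (\<Prod>k=1..m. real (divisor_sum (nth_prime k ^ a k)))"
    by (metis of_nat_le_iff of_nat_prod)
  also have "\<dots> = (\<Prod>k=1..m. real (nth_prime k ^ a k) * ((1 - (1 / real (nth_prime k)) ^ Suc (a k))
                     * (1 / (1 - 1 / real (nth_prime k)))))"
    by (intro prod.cong refl) (simp add: divisor_sum_prime_power prime_nth_prime del: of_nat_power power_Suc)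
  also have "\<dots> = real n * ((\<Prod>k=1..m. 1 - (1 / real (nth_prime k)) ^ Suc (a k))
                    * (\<Prod>k=1..m. 1 / (1 - 1 / real (nth_prime k))))"
    unfolding n_def prod.distrib of_nat_prod ..
  also have "(\<Prod>k=1..m. 1 / (1 - 1 / real (nth_prime k))) = (\<Prod>p\<in>primes_upto (nth_prime m). 1 / (1 - 1 / real p))"
    by (rule prod.reindex_bij_betw[OF bij_betw_nth_prime[OF m]])
  finally show ?thesis .
qed

text \<open>All factors lie in \<open>[0, 1]\<close>, so the one at \<open>k0\<close> bounds the product.\<close>

lemma bounded_exponent_factor_le:
  assumes k0: "k0 \<in> {1..m}" and A: "a k0 \<le> A"
  shows "(\<Prod>k=1..m. 1 - (1 / real (nth_prime k)) ^ Suc (a k)) \<le> 1 - (1 / real (nth_prime k0)) ^ Suc A"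
proof -
  let ?g = "\<lambda>k. 1 - (1 / real (nth_prime k)) ^ Suc (a k)"
  have g: "0 \<le> ?g k" "?g k \<le> 1" for k
    using nth_prime_ge_2[of k] power_le_one[of "1 / real (nth_prime k)" "Suc (a k)"] by auto
  have "(\<Prod>k=1..m. ?g k) = ?g k0 * (\<Prod>k\<in>{1..m} - {k0}. ?g k)"
    using k0 by (intro prod.remove) auto
  also have "\<dots> \<le> ?g k0 * 1" by (intro mult_left_mono prod_le_1 g conjI)
  also have "\<dots> \<le> 1 - (1 / real (nth_prime k0)) ^ Suc A"
    using A nth_prime_ge_2[of k0] power_decreasing[of "Suc (a k0)" "Suc A" "1 / real (nth_prime k0)"] by simp
  finally show ?thesis .
qed

section \<open>Integers close to a primorial\<close>

text \<open>If the first \<open>r\<close> exponents exceed their indices then, being non-increasing, they all exceed \<open>r\<close>.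
  The surplus \<open>\<Sum>(a k - 1) ln p\<^sub>k\<close>, which is \<open>e\<close> times the logarithm of the primorial, then
  contains \<open>r\<close> terms of size at least \<open>r ln 2\<close>.\<close>

lemma exceeding_exponents_bound:
  fixes a :: "nat \<Rightarrow> nat" and e :: real
  assumes m: "m \<ge> 1" and r: "r \<le> m" and dec: "antimono_on {1..m} a" and last: "a m \<ge> 1"
    and eq: "(\<Sum>k=1..m. real (a k) * ln (real (nth_prime k))) = (1 + e) * theta (nth_prime m)"
    and large: "\<And>k. k \<in> {1..r} \<Longrightarrow> a k > k"
  shows "real r ^ 2 * ln 2 \<le> e * theta (nth_prime m)"
proof -
  have anti: "a k \<le> a i" if "i \<in> {1..m}" "k \<in> {1..m}" "i \<le> k" for i k
    using dec that by (auto simp: monotone_on_def)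
  have ge1: "a k \<ge> 1" if "k \<in> {1..m}" for k using anti[of k m] that m last by auto
  have ger: "real (a k) - 1 \<ge> real r" if "k \<in> {1..r}" for k
    using anti[of k r] that r large[of r] by auto
  have l2: "ln 2 \<le> ln (real (nth_prime k))" for k using nth_prime_ge_2[of k] by (subst ln_le_cancel_iff) auto
  have l0: "0 \<le> ln (real (nth_prime k))" for k using nth_prime_ge_2[of k] by (intro ln_ge_zero) auto
  have "real r ^ 2 * ln 2 = (\<Sum>k=1..r. real r * ln 2)" by (simp add: power2_eq_square)
  also have "\<dots> \<le> (\<Sum>k=1..r. (real (a k) - 1) * ln (real (nth_prime k)))"
    by (intro sum_mono mult_mono ger l2) (use r in \<open>auto intro!: ge1[unfolded One_nat_def]\<close>)
  also have "\<dots> \<le> (\<Sum>k=1..m. (real (a k) - 1) * ln (real (nth_prime k)))"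
    by (intro sum_mono2 mult_nonneg_nonneg l0) (use r in \<open>auto intro!: ge1[unfolded One_nat_def]\<close>)
  also have "\<dots> = e * theta (nth_prime m)"
    using eq unfolding theta_nth_prime[OF m] by (simp add: left_diff_distrib sum_subtractf distrib_right)
  finally show ?thesis .
qed

theorem theorem4:
  fixes n m :: "nat \<Rightarrow> nat" and \<alpha> :: "nat \<Rightarrow> nat \<Rightarrow> nat" and \<epsilon> :: "nat \<Rightarrow> real"
  assumes n_ge: "\<And>j. j \<ge> 1 \<Longrightarrow> n j \<ge> 2"
    and n_lim: "filterlim n at_top sequentially"
    and m_ge: "\<And>j. j \<ge> 1 \<Longrightarrow> m j \<ge> 1"
    and n_eq: "\<And>j. j \<ge> 1 \<Longrightarrow> n j = (\<Prod>k=1..m j. nth_prime k ^ \<alpha> j k)"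
    and \<alpha>_decr: "\<And>j. j \<ge> 1 \<Longrightarrow> antimono_on {1..m j} (\<alpha> j)"
    and \<alpha>_ge: "\<And>j. j \<ge> 1 \<Longrightarrow> \<alpha> j (m j) \<ge> 1"
    and \<epsilon>_eq: "\<And>j. j \<ge> 1 \<Longrightarrow>
          real (n j) = (\<Prod>k=1..m j. real (nth_prime k)) powr (1 + \<epsilon> j)"
  shows "(\<epsilon> \<longlonglongrightarrow> 0 \<and>
          (\<exists>A K0 :: nat. A \<ge> 1 \<and> K0 \<ge> 1 \<and>
            (\<forall>j\<ge>1. m j \<ge> K0 \<longrightarrow> A \<ge> \<alpha> j K0 \<and> antimono_on {K0..m j} (\<alpha> j)))
          \<longrightarrow> (\<exists>L :: ereal. L > 0 \<and>
            (\<lambda>j. ereal (exp euler_mascheroni * real (n j) * ln (ln (real (n j)))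
                   - real (divisor_sum (n j)))) \<longlonglongrightarrow> L))
       \<and> (\<epsilon> \<longlonglongrightarrow> 0
          \<longrightarrow> (\<exists>(s :: nat \<Rightarrow> nat) (K :: nat \<Rightarrow> nat \<Rightarrow> nat).
            (\<forall>\<^sub>F j in sequentially. 1 \<le> s j \<and> s j \<le> m j \<and>
               (\<forall>i\<in>{1..s j}. K j i \<in> {1..m j} \<and> \<alpha> j (K j i) \<le> K j i)) \<and>
            (\<lambda>j. real (Min (K j ` {1..s j})) / real (m j)) \<longlonglongrightarrow> 0))"
proof -
  define p where "p j = nth_prime (m j)" for j
  obtain C where C: "C > 0" "\<And>m. m \<ge> 1 \<Longrightarrow> ln (real (nth_prime m)) \<le> C * real m"
    using ln_nth_prime_le by auto
  obtain c where c: "c > 0" "\<And>N. N \<ge> 2 \<Longrightarrow> theta N \<ge> c * real N"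
    using chebyshev_theta_lower by auto
  have p2: "p j \<ge> 2" for j unfolding p_def by (rule prime_ge_2_nat[OF prime_nth_prime])
  have npos: "real (nth_prime k) > 0" for k using nth_prime_ge_2[of k] by simp
  have theta_pos: "theta (p j) > 0" for j
    using c(2)[OF p2[of j]] c(1) p2[of j] by (smt (verit) mult_pos_pos of_nat_0_less_iff zero_less_numeral less_le_trans)
  have theta_p_le: "theta (p j) \<le> C * real (m j) ^ 2" if j: "j \<ge> 1" for j
  proof -
    have "theta (p j) \<le> (\<Sum>k=1..m j. C * real (m j))"
      unfolding p_def theta_nth_prime[OF m_ge[OF j]]
    proof (rule sum_mono)
      fix k assume k: "k \<in> {1..m j}"
      have "ln (real (nth_prime k)) \<le> C * real k" using k C(2) by simp
      also have "\<dots> \<le> C * real (m j)" using k C(1) by simp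
      finally show "ln (real (nth_prime k)) \<le> C * real (m j)" .
    qed
    thus ?thesis by (simp add: power2_eq_square algebra_simps)
  qed
  have ln_n: "ln (real (n j)) = (1 + \<epsilon> j) * theta (p j)" if j: "j \<ge> 1" for j
  proof -
    have "ln (real (n j)) = (1 + \<epsilon> j) * ln (\<Prod>k=1..m j. real (nth_prime k))"
      unfolding \<epsilon>_eq[OF j] by (rule ln_powr)
    also have "ln (\<Prod>k=1..m j. real (nth_prime k)) = theta (p j)"
      unfolding p_def theta_nth_prime[OF m_ge[OF j]] using npos by (intro ln_prod) (auto simp: less_imp_neq[symmetric])
    finally show ?thesis .
  qed
  have exponent_sum: "(\<Sum>k=1..m j. real (\<alpha> j k) * ln (real (nth_prime k))) = (1 + \<epsilon> j) * theta (p j)"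
    if j: "j \<ge> 1" for j
  proof -
    have "ln (real (n j)) = ln (\<Prod>k=1..m j. real (nth_prime k) ^ \<alpha> j k)" by (simp add: n_eq[OF j])
    also have "\<dots> = (\<Sum>k=1..m j. ln (real (nth_prime k) ^ \<alpha> j k))"
      using npos by (intro ln_prod) (auto simp: less_imp_neq[symmetric])
    also have "\<dots> = (\<Sum>k=1..m j. real (\<alpha> j k) * ln (real (nth_prime k)))"
      using npos by (simp add: ln_realpow)
    finally show ?thesis using ln_n[OF j] by simp
  qed

  have m_lim: "filterlim m at_top sequentially" if \<epsilon>: "\<epsilon> \<longlonglongrightarrow> 0"
  proof (subst filterlim_at_top, intro allI)
    fix Z :: nat
    have "filterlim (\<lambda>j. ln (real (n j))) at_top sequentially"
      by (rule filterlim_compose[OF ln_at_top filterlim_compose[OF filterlim_real_sequentially n_lim]])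
    hence "\<forall>\<^sub>F j in sequentially. ln (real (n j)) > 2 * C * real Z ^ 2"
      by (simp add: filterlim_at_top_dense)
    moreover have "\<forall>\<^sub>F j in sequentially. \<epsilon> j < 1" by (rule order_tendstoD[OF \<epsilon>]) simp
    ultimately show "\<forall>\<^sub>F j in sequentially. Z \<le> m j"
      using eventually_ge_at_top[of 1]
    proof eventually_elim
      case (elim j)
      have "ln (real (n j)) \<le> 2 * theta (p j)"
        unfolding ln_n[OF elim(3)] using elim(2) theta_pos[of j] by (intro mult_right_mono) auto
      also have "\<dots> \<le> 2 * C * real (m j) ^ 2" using theta_p_le[OF elim(3)] by simp
      finally have "2 * C * real Z ^ 2 < 2 * C * real (m j) ^ 2" using elim(1) by linarith
      hence "real Z ^ 2 < real (m j) ^ 2" using C(1) by simp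
      hence "real Z < real (m j)" by (rule power_less_imp_less_base) simp
      thus ?case by simp
    qed
  qed

  have part1: "\<exists>L :: ereal. L > 0 \<and>
            (\<lambda>j. ereal (exp euler_mascheroni * real (n j) * ln (ln (real (n j)))
                   - real (divisor_sum (n j)))) \<longlonglongrightarrow> L"
    if \<epsilon>: "\<epsilon> \<longlonglongrightarrow> 0" and K0: "K0 \<ge> 1" and A: "\<And>j. j \<ge> 1 \<Longrightarrow> m j \<ge> K0 \<Longrightarrow> \<alpha> j K0 \<le> A"
    for A K0
  proof -
    let ?G = "exp euler_mascheroni :: real"
    let ?d = "\<lambda>j. ?G * real (n j) * ln (ln (real (n j))) - real (divisor_sum (n j))"
    \<comment> \<open>The relative loss \<open>c0\<close> caused by the bounded exponent at \<open>K0\<close>; it is also used as the tolerance in Mertens' theorem, so that \<open>(1 - c0) (1 + c0) = 1 - c0\<^sup>2\<close> is still below 1.\<close>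
    define c0 where "c0 = (1 / real (nth_prime K0)) ^ Suc A"
    have c0: "0 < c0" "c0 < 1"
      unfolding c0_def using nth_prime_ge_2[of K0] by (auto simp del: power_Suc intro!: power_less_one_iff[THEN iffD2])
    \<comment> \<open>\<open>n\<close> exceeds the primorial to the power 1/2 and the primorial is at least \<open>exp (c p)\<close>, so \<open>ln (ln n)\<close> falls below \<open>ln p\<close> by at most \<open>C1\<close>.\<close>
    define C1 where "C1 = - ln (1 / 2 * c)"
    have p_lim: "filterlim p at_top sequentially"
    proof (rule filterlim_at_top_mono)
      show "filterlim (\<lambda>j. m j - 1) at_top sequentially"
        by (rule filterlim_compose[OF filterlim_minus_const_nat_at_top m_lim[OF \<epsilon>]])
      show "\<forall>\<^sub>F j in sequentially. m j - 1 \<le> p j"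
        unfolding p_def using le_nth_prime by (auto simp: le_diff_conv)
    qed
    have lnp_lim: "filterlim (\<lambda>j. ln (real (p j))) at_top sequentially"
      by (rule filterlim_compose[OF ln_at_top filterlim_compose[OF filterlim_real_sequentially p_lim]])
    have lower_lim: "filterlim (\<lambda>j. ?G * (- C1 + c0\<^sup>2 * ln (real (p j)))) at_top sequentially"
      using c0 by (intro filterlim_tendsto_pos_mult_at_top[OF tendsto_const] lnp_lim
           filterlim_tendsto_add_at_top[OF tendsto_const]) auto
    have "\<forall>\<^sub>F j in sequentially. ?G * (- C1 + c0\<^sup>2 * ln (real (p j))) \<ge> 0"
      using lower_lim by (simp only: filterlim_at_top)
    moreover have "\<forall>\<^sub>F j in sequentially. \<epsilon> j > - 1 / 2" by (rule order_tendstoD[OF \<epsilon>]) simp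
    moreover have "\<forall>\<^sub>F j in sequentially. m j \<ge> K0" using m_lim[OF \<epsilon>] by (simp only: filterlim_at_top)
    moreover have "\<forall>\<^sub>F j in sequentially. (\<Prod>q\<in>primes_upto (p j). 1 / (1 - 1 / real q)) \<le> (1 + c0) * ?G * ln (real (p j))"
      using p_lim mertens_third_upper[OF c0(1)] by (rule eventually_compose_filterlim[rotated])
    ultimately have "\<forall>\<^sub>F j in sequentially. ?G * (- C1 + c0\<^sup>2 * ln (real (p j))) \<le> ?d j"
      using eventually_ge_at_top[of 1]
    proof eventually_elim
      case (elim j)
      let ?lp = "ln (real (p j))"
      have pj: "real (p j) \<ge> 2" using p2[of j] by simp
      have "(1 / 2 * c) * real (p j) \<le> (1 + \<epsilon> j) * theta (p j)"
        using c(1) c(2)[OF p2[of j]] elim(2) by (subst mult.assoc, intro mult_mono) auto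
      hence "ln ((1 / 2 * c) * real (p j)) \<le> ln (ln (real (n j)))"
        unfolding ln_n[OF elim(5)] using c(1) pj elim(2) theta_pos[of j]
        by (subst ln_le_cancel_iff) auto
      moreover have "ln ((1 / 2 * c) * real (p j)) = - C1 + ?lp"
        unfolding C1_def using c(1) pj by (subst ln_mult) auto
      ultimately have lln: "- C1 + ?lp \<le> ln (ln (real (n j)))" by simp
      have "real (divisor_sum (n j)) \<le> real (n j) * ((\<Prod>k=1..m j. 1 - (1 / real (nth_prime k)) ^ Suc (\<alpha> j k))
             * (\<Prod>q\<in>primes_upto (p j). 1 / (1 - 1 / real q)))"
        using divisor_sum_prime_product_le[OF m_ge[OF elim(5)], of "\<alpha> j"]
        unfolding n_eq[OF elim(5), symmetric] p_def .
      also have "\<dots> \<le> real (n j) * ((1 - c0) * ((1 + c0) * ?G * ?lp))"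
      proof (intro mult_left_mono mult_mono)
        show "(\<Prod>k=1..m j. 1 - (1 / real (nth_prime k)) ^ Suc (\<alpha> j k)) \<le> 1 - c0"
          unfolding c0_def using elim K0 A[of j] by (intro bounded_exponent_factor_le) auto
        show "0 \<le> (\<Prod>q\<in>primes_upto (p j). 1 / (1 - 1 / real q))"
          by (intro prod_nonneg) (auto dest!: primes_upto_ge_2)
      qed (use elim c0 in auto)
      also have "\<dots> = ?G * real (n j) * (?lp - c0\<^sup>2 * ?lp)" by (simp add: algebra_simps power2_eq_square)
      finally have s: "real (divisor_sum (n j)) \<le> ?G * real (n j) * (?lp - c0\<^sup>2 * ?lp)" .
      have "?G * (- C1 + c0\<^sup>2 * ?lp) \<le> real (n j) * (?G * (- C1 + c0\<^sup>2 * ?lp))"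
        using elim(1) n_ge[OF elim(5)] by (intro mult_le_cancel_right1[THEN iffD2]) auto
      also have "\<dots> = ?G * real (n j) * (- C1 + ?lp) - ?G * real (n j) * (?lp - c0\<^sup>2 * ?lp)"
        by (simp add: algebra_simps)
      also have "\<dots> \<le> ?d j"
        using s lln by (intro diff_mono mult_left_mono) auto
      finally show ?case .
    qed
    hence "filterlim ?d at_top sequentially"
      by (rule filterlim_at_top_mono[OF lower_lim])
    hence "(\<lambda>j. ereal (?d j)) \<longlonglongrightarrow> \<infinity>" by (simp add: tendsto_PInfty_eq_at_top)
    thus ?thesis by (intro exI[of _ \<infinity>]) simp
  qed

  have part2: "\<exists>(s :: nat \<Rightarrow> nat) (K :: nat \<Rightarrow> nat \<Rightarrow> nat).
            (\<forall>\<^sub>F j in sequentially. 1 \<le> s j \<and> s j \<le> m j \<and>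
               (\<forall>i\<in>{1..s j}. K j i \<in> {1..m j} \<and> \<alpha> j (K j i) \<le> K j i)) \<and>
            (\<lambda>j. real (Min (K j ` {1..s j})) / real (m j)) \<longlonglongrightarrow> 0"
    if \<epsilon>: "\<epsilon> \<longlonglongrightarrow> 0"
  proof -
    \<comment> \<open>One index per \<open>j\<close> suffices: the least \<open>k\<close> with \<open>\<alpha> j k \<le> k\<close>.\<close>
    define T where "T j = {k\<in>{1..m j}. \<alpha> j k \<le> k}" for j
    define B where "B = C / ln 2"
    have B: "B > 0" unfolding B_def using C(1) by simp
    \<comment> \<open>Compares the quadratic lower bound for the surplus with the quadratic upper bound for the primorial.\<close>
    have bound: "real r / real (m j) \<le> sqrt (\<epsilon> j * B)" "real r ^ 2 \<le> \<epsilon> j * B * real (m j) ^ 2"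
      if j: "j \<ge> 1" and r: "r \<le> m j" and large: "\<And>k. k \<in> {1..r} \<Longrightarrow> \<alpha> j k > k" for j r
    proof -
      have l2: "ln 2 > (0::real)" by simp
      have 1: "real r ^ 2 * ln 2 \<le> \<epsilon> j * theta (p j)"
        unfolding p_def
        by (rule exceeding_exponents_bound[OF m_ge[OF j] r \<alpha>_decr[OF j] \<alpha>_ge[OF j] _ large])
           (use exponent_sum[OF j] in \<open>simp_all add: p_def\<close>)
      have "0 \<le> real r ^ 2 * ln 2" by simp
      hence "0 \<le> \<epsilon> j * theta (p j)" using 1 by linarith
      hence "\<epsilon> j \<ge> 0" using theta_pos[of j] by (simp add: zero_le_mult_iff)
      hence "\<epsilon> j * theta (p j) \<le> \<epsilon> j * (C * real (m j) ^ 2)"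
        using theta_p_le[OF j] by (intro mult_left_mono)
      with 1 have "real r ^ 2 * ln 2 \<le> \<epsilon> j * (C * real (m j) ^ 2)" by linarith
      thus 2: "real r ^ 2 \<le> \<epsilon> j * B * real (m j) ^ 2"
        unfolding B_def using l2 by (simp add: pos_le_divide_eq mult.assoc)
      show "real r / real (m j) \<le> sqrt (\<epsilon> j * B)"
        using 2 m_ge[OF j] by (intro real_le_rsqrt) (simp add: power_divide pos_divide_le_eq)
    qed
    have eB: "(\<lambda>j. \<epsilon> j * B) \<longlonglongrightarrow> 0"
      using tendsto_mult[OF \<epsilon> tendsto_const[of B]] by simp
    have "\<forall>\<^sub>F j in sequentially. \<epsilon> j * B < 1" by (rule order_tendstoD[OF eB]) simp
    hence T_ne: "\<forall>\<^sub>F j in sequentially. j \<ge> 1 \<and> T j \<noteq> {}"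
      using eventually_ge_at_top[of 1]
    proof eventually_elim
      case (elim j)
      have "T j \<noteq> {}"
      proof
        assume "T j = {}"
        hence "\<alpha> j k > k" if "k \<in> {1..m j}" for k using that by (force simp: T_def)
        hence "real (m j) ^ 2 \<le> \<epsilon> j * B * real (m j) ^ 2" by (intro bound(2)) (use elim in auto)
        hence "1 \<le> \<epsilon> j * B" using m_ge[OF elim(2)] by simp
        thus False using elim by simp
      qed
      thus ?case using elim by simp
    qed
    have fin: "finite (T j)" for j by (simp add: T_def)
    have T_pos: "T j \<subseteq> {1..}" for j by (auto simp: T_def)
    have "\<forall>\<^sub>F j in sequentially. 1 \<le> m j \<and> Min (T j) \<in> {1..m j} \<and> \<alpha> j (Min (T j)) \<le> Min (T j)"
      using T_ne
    proof eventually_elim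
      case (elim j)
      have "Min (T j) \<in> T j" using elim fin by (intro Min_in) auto
      thus ?case using elim m_ge[of j] by (auto simp: T_def)
    qed
    moreover have "(\<lambda>j. real (Min (T j)) / real (m j)) \<longlonglongrightarrow> 0"
    proof (rule tendsto_sandwich[OF _ _ tendsto_const])
      show "\<forall>\<^sub>F j in sequentially. 0 \<le> real (Min (T j)) / real (m j)" by simp
      show "\<forall>\<^sub>F j in sequentially. real (Min (T j)) / real (m j) \<le> sqrt (\<epsilon> j * B) + 1 / real (m j)"
        using T_ne
      proof eventually_elim
        case (elim j)
        have in_T: "Min (T j) \<in> T j" using elim fin by (intro Min_in) auto
        have "\<alpha> j k > k" if k: "k \<in> {1..Min (T j) - 1}" for k
        proof -
          have "k \<notin> T j" using k Min_le[OF fin[of j], of k] by auto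
          thus ?thesis using k in_T by (auto simp: T_def)
        qed
        hence "real (Min (T j) - 1) / real (m j) \<le> sqrt (\<epsilon> j * B)"
          by (intro bound(1)) (use elim in_T in \<open>auto simp: T_def\<close>)
        moreover have "Min (T j) \<ge> 1" using in_T T_pos[of j] by auto
        hence "real (Min (T j)) = real (Min (T j) - 1) + 1" by linarith
        hence "real (Min (T j)) / real (m j) = real (Min (T j) - 1) / real (m j) + 1 / real (m j)"
          by (simp only: add_divide_distrib)
        ultimately show ?case by linarith
      qed
      have "(\<lambda>j. sqrt (\<epsilon> j * B) + 1 / real (m j)) \<longlonglongrightarrow> sqrt 0 + 0"
        by (intro tendsto_add tendsto_real_sqrt eB filterlim_compose[OF lim_1_over_n m_lim[OF \<epsilon>]])
      thus "(\<lambda>j. sqrt (\<epsilon> j * B) + 1 / real (m j)) \<longlonglongrightarrow> 0" by simp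
    qed
    ultimately show ?thesis
      by (intro exI[of _ "\<lambda>_. 1"] exI[of _ "\<lambda>j _. Min (T j)"]) simp
  qed
  show ?thesis using part1 part2 by blast
qed

end
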